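(* Uniform perpendiculars can be constructed in intuitionistic Tarski geometry without any continuity axioms. Explicitly: there is a term $Project(x,a,b,w)$ of intuitionistic Tarski geometry with Skolem functions and without continuity, such that the theory proves: if $a\neq b$, $w$ is any point not on $L=\mathrm{Line}(a,b)$ (i.e. $\neg Col(a,b,w)$), $x$ is any point (on $L$ or not), and $f=Project(x,a,b,w)$, then $Col(a,b,f)$ and the perpendicular to $L$ erected at $f$ contains $x$.
   Context: Language: one sort (points), equality, strict betweenness $B(a,b,c)$, congruence $E(a,b,c,d)$ written $ab=cd$, constants $\alpha,\beta,\gamma$, and (total) function symbols $ext$ (4-ary), $ip$ (5-ary), $center$ (3-ary). Abbreviations: $T(a,b,c):=\neg(a\neq b\land b\neq c\land\neg B(a,b,c))$; $Col(a,b,c):=\neg(\neg T(c,a,b)\land\neg T(a,c,b)\land\neg T(a,b,c))$. For $a\ne b$, "$x$ lies on $\mathrm{Line}(a,b)$" means $Col(a,b,x)$. Perpendicularity: $abc$ is a right angle ($a\neq b$, $b\neq c$), written $ab\perp bc$, if for $d$ with $B(d,b,c)$ and $db=bc$ we have $ad=ac$. Lines $K$ and $L$ are perpendicular at $f$ if $f$ lies on both and there are points $k\ne f$ on $K$ and $l\ne f$ on $L$ with $kf\perp fl$. The erected perpendicular to $L$ at a point $f$ of $L$ is the line perpendicular to $L$ at $f$. Intuitionistic Tarski geometry with Skolem functions and without any continuity axioms has intuitionistic predicate logic with equality and the axioms: (A1) $ab=ba$; (A2) $ab=pq\land ab=rs\to pq=rs$; (A3) $ab=cc\to a=b$; (A4-i)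 $q\neq a\to T(q,a,x)\land ax=bc$ with $x=ext(q,a,b,c)$; (A5) $a\neq b\land T(a,b,c)\land T(A,B,C)\land ab=AB\land bc=BC\land ad=AD\land bd=BD\to cd=CD$; (A6-i) $\neg B(a,b,a)$; (A7-i) $B(a,p,c)\land T(b,q,c)\land\neg Col(a,b,c)\to T(p,x,b)\land T(q,x,a)$ with $x=ip(a,p,c,b,q)$; (A8) $\neg Col(\alpha,\beta,\gamma)$; (A9) $a\neq b\land pa=pb\land qa=qb\land ra=rb\to Col(p,q,r)$; (A10$_3$) $\neg Col(a,b,c)\to ax=bx\land ax=cx$ with $x=center(a,b,c)$; (A14-i) $B(a,b,c)\to B(c,b,a)$; (A15-i) $B(a,b,d)\land B(b,c,d)\to B(a,b,c)$; stability: $\neg\neg B(a,b,c)\to B(a,b,c)$, $\neg\neg ab=cd\to ab=cd$, $\neg a\neq b\to a=b$. *)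

theory Defs
  imports Main
begin

text \<open>
  Intuitionistic Tarski geometry is rendered as a deeply embedded first-order theory: de Bruijn
  terms and formulas, a natural deduction calculus for intuitionistic logic with equality, and
  the set of (universally closed) axioms.
\<close>

datatype tm =
    Var nat
  | Alpha | Beta | Gamma
  | Ext tm tm tm tm
  | Ip tm tm tm tm tm
  | Center tm tm tm

datatype fm =
    Falsum
  | Eq tm tm                (infix "\<^bold>=" 65)
  | Between tm tm tm
  | Cong tm tm tm tm
  | And fm fm               (infixr "\<^bold>\<and>" 55)
  | Or fm fm                (infixr "\<^bold>\<or>" 54)
  | Imp fm fm               (infixr "\<^bold>\<longrightarrow>" 53)
  | Forall fm
  | Exists fm

abbreviation Neg :: "fm \<Rightarrow> fm" ("\<^bold>\<not> _" [60] 60) where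
  "\<^bold>\<not> p \<equiv> p \<^bold>\<longrightarrow> Falsum"

abbreviation Neq :: "tm \<Rightarrow> tm \<Rightarrow> fm" (infix "\<^bold>\<noteq>" 65) where
  "s \<^bold>\<noteq> t \<equiv> \<^bold>\<not> (s \<^bold>= t)"

primrec tvars :: "tm \<Rightarrow> nat set" where
  "tvars (Var n) = {n}"
| "tvars Alpha = {}"
| "tvars Beta = {}"
| "tvars Gamma = {}"
| "tvars (Ext q a b c) = tvars q \<union> tvars a \<union> tvars b \<union> tvars c"
| "tvars (Ip a p c b q) = tvars a \<union> tvars p \<union> tvars c \<union> tvars b \<union> tvars q"
| "tvars (Center a b c) = tvars a \<union> tvars b \<union> tvars c"

primrec subst_tm :: "(nat \<Rightarrow> tm) \<Rightarrow> tm \<Rightarrow> tm" where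
  "subst_tm \<sigma> (Var n) = \<sigma> n"
| "subst_tm \<sigma> Alpha = Alpha"
| "subst_tm \<sigma> Beta = Beta"
| "subst_tm \<sigma> Gamma = Gamma"
| "subst_tm \<sigma> (Ext q a b c) =
     Ext (subst_tm \<sigma> q) (subst_tm \<sigma> a) (subst_tm \<sigma> b) (subst_tm \<sigma> c)"
| "subst_tm \<sigma> (Ip a p c b q) =
     Ip (subst_tm \<sigma> a) (subst_tm \<sigma> p) (subst_tm \<sigma> c) (subst_tm \<sigma> b) (subst_tm \<sigma> q)"
| "subst_tm \<sigma> (Center a b c) = Center (subst_tm \<sigma> a) (subst_tm \<sigma> b) (subst_tm \<sigma> c)"

definition lift_tm :: "tm \<Rightarrow> tm" where
  "lift_tm = subst_tm (\<lambda>n. Var (Suc n))"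

definition under_binder :: "(nat \<Rightarrow> tm) \<Rightarrow> nat \<Rightarrow> tm" where
  "under_binder \<sigma> = case_nat (Var 0) (\<lambda>n. lift_tm (\<sigma> n))"

primrec subst_fm :: "(nat \<Rightarrow> tm) \<Rightarrow> fm \<Rightarrow> fm" where
  "subst_fm \<sigma> Falsum = Falsum"
| "subst_fm \<sigma> (s \<^bold>= t) = (subst_tm \<sigma> s \<^bold>= subst_tm \<sigma> t)"
| "subst_fm \<sigma> (Between a b c) = Between (subst_tm \<sigma> a) (subst_tm \<sigma> b) (subst_tm \<sigma> c)"
| "subst_fm \<sigma> (Cong a b c d) =
     Cong (subst_tm \<sigma> a) (subst_tm \<sigma> b) (subst_tm \<sigma> c) (subst_tm \<sigma> d)"
| "subst_fm \<sigma> (p \<^bold>\<and> q) = (subst_fm \<sigma> p \<^bold>\<and> subst_fm \<sigma> q)"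
| "subst_fm \<sigma> (p \<^bold>\<or> q) = (subst_fm \<sigma> p \<^bold>\<or> subst_fm \<sigma> q)"
| "subst_fm \<sigma> (p \<^bold>\<longrightarrow> q) = (subst_fm \<sigma> p \<^bold>\<longrightarrow> subst_fm \<sigma> q)"
| "subst_fm \<sigma> (Forall p) = Forall (subst_fm (under_binder \<sigma>) p)"
| "subst_fm \<sigma> (Exists p) = Exists (subst_fm (under_binder \<sigma>) p)"

definition lift_fm :: "fm \<Rightarrow> fm" where
  "lift_fm = subst_fm (\<lambda>n. Var (Suc n))"

text \<open>\<open>inst p t\<close> replaces index 0 by \<open>t\<close> and lowers all other free indices by one.\<close>

definition inst :: "fm \<Rightarrow> tm \<Rightarrow> fm" where
  "inst p t = subst_fm (case_nat t Var) p"

text \<open>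
  The eigenvariable of \<open>ForallI\<close> and \<open>ExistsE\<close> is index 0, which is fresh because all other
  formulas are lifted.
\<close>

inductive derives :: "fm set \<Rightarrow> fm \<Rightarrow> bool" (infix "\<turnstile>" 50) where
  Assm: "p \<in> \<Gamma> \<Longrightarrow> \<Gamma> \<turnstile> p"
| FalsumE: "\<Gamma> \<turnstile> Falsum \<Longrightarrow> \<Gamma> \<turnstile> p"
| AndI: "\<Gamma> \<turnstile> p \<Longrightarrow> \<Gamma> \<turnstile> q \<Longrightarrow> \<Gamma> \<turnstile> p \<^bold>\<and> q"
| AndE1: "\<Gamma> \<turnstile> p \<^bold>\<and> q \<Longrightarrow> \<Gamma> \<turnstile> p"
| AndE2: "\<Gamma> \<turnstile> p \<^bold>\<and> q \<Longrightarrow> \<Gamma> \<turnstile> q"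
| OrI1: "\<Gamma> \<turnstile> p \<Longrightarrow> \<Gamma> \<turnstile> p \<^bold>\<or> q"
| OrI2: "\<Gamma> \<turnstile> q \<Longrightarrow> \<Gamma> \<turnstile> p \<^bold>\<or> q"
| OrE: "\<Gamma> \<turnstile> p \<^bold>\<or> q \<Longrightarrow> insert p \<Gamma> \<turnstile> r \<Longrightarrow> insert q \<Gamma> \<turnstile> r \<Longrightarrow> \<Gamma> \<turnstile> r"
| ImpI: "insert p \<Gamma> \<turnstile> q \<Longrightarrow> \<Gamma> \<turnstile> p \<^bold>\<longrightarrow> q"
| ImpE: "\<Gamma> \<turnstile> p \<^bold>\<longrightarrow> q \<Longrightarrow> \<Gamma> \<turnstile> p \<Longrightarrow> \<Gamma> \<turnstile> q"
| ForallI: "lift_fm ` \<Gamma> \<turnstile> p \<Longrightarrow> \<Gamma> \<turnstile> Forall p"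
| ForallE: "\<Gamma> \<turnstile> Forall p \<Longrightarrow> \<Gamma> \<turnstile> inst p t"
| ExistsI: "\<Gamma> \<turnstile> inst p t \<Longrightarrow> \<Gamma> \<turnstile> Exists p"
| ExistsE: "\<Gamma> \<turnstile> Exists p \<Longrightarrow> insert p (lift_fm ` \<Gamma>) \<turnstile> lift_fm q \<Longrightarrow> \<Gamma> \<turnstile> q"
| EqRefl: "\<Gamma> \<turnstile> t \<^bold>= t"
| EqSubst: "\<Gamma> \<turnstile> s \<^bold>= t \<Longrightarrow> \<Gamma> \<turnstile> inst p s \<Longrightarrow> \<Gamma> \<turnstile> inst p t"

definition Foralls :: "nat \<Rightarrow> fm \<Rightarrow> fm" where
  "Foralls n p = (Forall ^^ n) p"

text \<open>\<open>Between\<close> is strict betweenness B; \<open>WBetween\<close> is the defined nonstrict relation T.\<close>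

definition WBetween :: "tm \<Rightarrow> tm \<Rightarrow> tm \<Rightarrow> fm" where
  "WBetween a b c = \<^bold>\<not> (a \<^bold>\<noteq> b \<^bold>\<and> b \<^bold>\<noteq> c \<^bold>\<and> \<^bold>\<not> Between a b c)"

definition Col :: "tm \<Rightarrow> tm \<Rightarrow> tm \<Rightarrow> fm" where
  "Col a b c = \<^bold>\<not> (\<^bold>\<not> WBetween c a b \<^bold>\<and> \<^bold>\<not> WBetween a c b \<^bold>\<and> \<^bold>\<not> WBetween a b c)"

definition A1 :: "tm \<Rightarrow> tm \<Rightarrow> fm" where
  "A1 a b = Cong a b b a"

definition A2 :: "tm \<Rightarrow> tm \<Rightarrow> tm \<Rightarrow> tm \<Rightarrow> tm \<Rightarrow> tm \<Rightarrow> fm" where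
  "A2 a b p q r s = (Cong a b p q \<^bold>\<and> Cong a b r s \<^bold>\<longrightarrow> Cong p q r s)"

definition A3 :: "tm \<Rightarrow> tm \<Rightarrow> tm \<Rightarrow> fm" where
  "A3 a b c = (Cong a b c c \<^bold>\<longrightarrow> a \<^bold>= b)"

definition A4i :: "tm \<Rightarrow> tm \<Rightarrow> tm \<Rightarrow> tm \<Rightarrow> fm" where
  "A4i q a b c = (let x = Ext q a b c in q \<^bold>\<noteq> a \<^bold>\<longrightarrow> WBetween q a x \<^bold>\<and> Cong a x b c)"

definition A5 :: "tm \<Rightarrow> tm \<Rightarrow> tm \<Rightarrow> tm \<Rightarrow> tm \<Rightarrow> tm \<Rightarrow> tm \<Rightarrow> tm \<Rightarrow> fm" where
  "A5 a b c d a' b' c' d' =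
     (a \<^bold>\<noteq> b \<^bold>\<and> WBetween a b c \<^bold>\<and> WBetween a' b' c' \<^bold>\<and> Cong a b a' b' \<^bold>\<and> Cong b c b' c' \<^bold>\<and>
      Cong a d a' d' \<^bold>\<and> Cong b d b' d' \<^bold>\<longrightarrow> Cong c d c' d')"

definition A6i :: "tm \<Rightarrow> tm \<Rightarrow> fm" where
  "A6i a b = \<^bold>\<not> Between a b a"

definition A7i :: "tm \<Rightarrow> tm \<Rightarrow> tm \<Rightarrow> tm \<Rightarrow> tm \<Rightarrow> fm" where
  "A7i a p c b q = (let x = Ip a p c b q in
     Between a p c \<^bold>\<and> WBetween b q c \<^bold>\<and> \<^bold>\<not> Col a b c \<^bold>\<longrightarrow> WBetween p x b \<^bold>\<and> WBetween q x a)"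

definition A8 :: fm where
  "A8 = \<^bold>\<not> Col Alpha Beta Gamma"

definition A9 :: "tm \<Rightarrow> tm \<Rightarrow> tm \<Rightarrow> tm \<Rightarrow> tm \<Rightarrow> fm" where
  "A9 a b p q r =
     (a \<^bold>\<noteq> b \<^bold>\<and> Cong p a p b \<^bold>\<and> Cong q a q b \<^bold>\<and> Cong r a r b \<^bold>\<longrightarrow> Col p q r)"

definition A10\<^sub>3 :: "tm \<Rightarrow> tm \<Rightarrow> tm \<Rightarrow> fm" where
  "A10\<^sub>3 a b c = (let x = Center a b c in \<^bold>\<not> Col a b c \<^bold>\<longrightarrow> Cong a x b x \<^bold>\<and> Cong a x c x)"

definition A14i :: "tm \<Rightarrow> tm \<Rightarrow> tm \<Rightarrow> fm" where
  "A14i a b c = (Between a b c \<^bold>\<longrightarrow> Between c b a)"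

definition A15i :: "tm \<Rightarrow> tm \<Rightarrow> tm \<Rightarrow> tm \<Rightarrow> fm" where
  "A15i a b c d = (Between a b d \<^bold>\<and> Between b c d \<^bold>\<longrightarrow> Between a b c)"

definition stable :: "fm \<Rightarrow> fm" where
  "stable p = (\<^bold>\<not> \<^bold>\<not> p \<^bold>\<longrightarrow> p)"

definition intuitionistic_tarski :: "fm set" where
  "intuitionistic_tarski =
    {Foralls 2 (A1 (Var 0) (Var 1)),
     Foralls 6 (A2 (Var 0) (Var 1) (Var 2) (Var 3) (Var 4) (Var 5)),
     Foralls 3 (A3 (Var 0) (Var 1) (Var 2)),
     Foralls 4 (A4i (Var 0) (Var 1) (Var 2) (Var 3)),
     Foralls 8 (A5 (Var 0) (Var 1) (Var 2) (Var 3) (Var 4) (Var 5) (Var 6) (Var 7)),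
     Foralls 2 (A6i (Var 0) (Var 1)),
     Foralls 5 (A7i (Var 0) (Var 1) (Var 2) (Var 3) (Var 4)),
     A8,
     Foralls 5 (A9 (Var 0) (Var 1) (Var 2) (Var 3) (Var 4)),
     Foralls 3 (A10\<^sub>3 (Var 0) (Var 1) (Var 2)),
     Foralls 3 (A14i (Var 0) (Var 1) (Var 2)),
     Foralls 4 (A15i (Var 0) (Var 1) (Var 2) (Var 3)),
     Foralls 3 (stable (Between (Var 0) (Var 1) (Var 2))),
     Foralls 4 (stable (Cong (Var 0) (Var 1) (Var 2) (Var 3))),
     Foralls 2 (stable (Var 0 \<^bold>= Var 1))}"

definition RightAngle :: "tm \<Rightarrow> tm \<Rightarrow> tm \<Rightarrow> fm" where
  "RightAngle a b c = (a \<^bold>\<noteq> b \<^bold>\<and> b \<^bold>\<noteq> c \<^bold>\<and>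
     Forall (let d = Var 0; a = lift_tm a; b = lift_tm b; c = lift_tm c in
       Between d b c \<^bold>\<and> Cong d b b c \<^bold>\<longrightarrow> Cong a d a c))"

text \<open>\<open>PerpAt p q a b f\<close>: Line(p,q) and Line(a,b) are perpendicular at f.\<close>

definition PerpAt :: "tm \<Rightarrow> tm \<Rightarrow> tm \<Rightarrow> tm \<Rightarrow> tm \<Rightarrow> fm" where
  "PerpAt p q a b f = (p \<^bold>\<noteq> q \<^bold>\<and> a \<^bold>\<noteq> b \<^bold>\<and> Col p q f \<^bold>\<and> Col a b f \<^bold>\<and>
     Exists (Exists
       (let k = Var 1; l = Var 0;
            p = lift_tm (lift_tm p); q = lift_tm (lift_tm q);
            a = lift_tm (lift_tm a); b = lift_tm (lift_tm b); f = lift_tm (lift_tm f)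
        in k \<^bold>\<noteq> f \<^bold>\<and> Col p q k \<^bold>\<and> l \<^bold>\<noteq> f \<^bold>\<and> Col a b l \<^bold>\<and> RightAngle k f l)))"

text \<open>
  The definite description ``the perpendicular to Line(a,b) erected at f contains x'' is read as:
  a line perpendicular to Line(a,b) at f exists, and any such line contains x.
\<close>

definition ErectedPerpContains :: "tm \<Rightarrow> tm \<Rightarrow> tm \<Rightarrow> tm \<Rightarrow> fm" where
  "ErectedPerpContains a b f x =
     (let a = lift_tm (lift_tm a); b = lift_tm (lift_tm b);
          f = lift_tm (lift_tm f); x = lift_tm (lift_tm x);
          p = Var 1; q = Var 0
      in Exists (Exists (PerpAt p q a b f)) \<^bold>\<and>
         Forall (Forall (PerpAt p q a b f \<^bold>\<longrightarrow> Col p q x)))"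

end

theory Submission
  imports Defs
begin

text \<open>
  Atomic formulas are stable and the axioms are universal formulas without disjunction. Hence if a
  maximal consistent set of formulas always contains a stable quantifier-free formula, the formula
  is intuitionistically derivable; and the terms modulo provable equality in such a set form a
  classical model. So it suffices to find one term that projects in all classical models, together
  with terms witnessing the existential quantifiers.

  Let \<open>c\<close> be the foot of \<open>w\<close> on \<open>L\<close> and choose \<open>e\<close> on the ray \<open>cw\<close> with \<open>ce > cx\<close>. The
  reflection \<open>M\<close> of \<open>L\<close> in \<open>e\<close> is disjoint from \<open>L\<close>, and it misses \<open>x\<close> because a hypotenuse is
  longer than a leg. So the foot \<open>g\<close> of \<open>x\<close> on \<open>M\<close> and then the foot \<open>f\<close> of \<open>g\<close> on \<open>L\<close> can be
  dropped without knowing whether \<open>x\<close> lies on \<open>L\<close>. By the triangle circumscription axiom, a line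
  perpendicular to one of the disjoint lines \<open>L\<close> and \<open>M\<close> and meeting the other is perpendicular to
  both, so \<open>x\<close> lies on \<open>fg\<close>.
\<close>

section \<open>Classical Tarski planes\<close>

text \<open>Dropping a perpendicular requires a point off the line and erecting one a point on it.
  Intuitionistically these cases cannot be told apart, so the two constructions cannot be merged
  into one term by cases. Double negations can be removed only from atomic formulas and from
  negations such as \<open>Col\<close>. The quantifiers inside perpendicularity are therefore kept
  out of the semantic argument: existential claims receive explicit terms, and the hypothesis that
  an angle is right is used at a single term, the mirror image of one arm's point in the vertex.
  Quantified members of a maximal consistent set are never evaluated, so no Henkin witnesses are
  required. Without continuity, circles cannot be intersected with lines. Midpoints come from
  circumcenters together with Pasch, and feet from these midpoints. That a hypotenuse exceeds a leg
  is shown by separation arguments, which is why the sides of a line are developed at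
  length.\<close>

locale betweenness =
  fixes B :: "'a \<Rightarrow> 'a \<Rightarrow> 'a \<Rightarrow> bool"
begin

definition T :: "'a \<Rightarrow> 'a \<Rightarrow> 'a \<Rightarrow> bool" where
  "T a b c \<longleftrightarrow> a = b \<or> b = c \<or> B a b c"

definition Col :: "'a \<Rightarrow> 'a \<Rightarrow> 'a \<Rightarrow> bool" where
  "Col a b c \<longleftrightarrow> T c a b \<or> T a c b \<or> T a b c"

end

text \<open>Congruence \<open>ab = cd\<close> is modelled as equality of the lengths of \<open>ab\<close> and \<open>cd\<close>.\<close>

locale tarski_plane = betweenness B
  for B :: "'a \<Rightarrow> 'a \<Rightarrow> 'a \<Rightarrow> bool" +
  fixes len :: "'a \<Rightarrow> 'a \<Rightarrow> 'l"
    and ext :: "'a \<Rightarrow> 'a \<Rightarrow> 'a \<Rightarrow> 'a \<Rightarrow> 'a"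
    and ip :: "'a \<Rightarrow> 'a \<Rightarrow> 'a \<Rightarrow> 'a \<Rightarrow> 'a \<Rightarrow> 'a"
    and center :: "'a \<Rightarrow> 'a \<Rightarrow> 'a \<Rightarrow> 'a"
    and \<alpha> \<beta> \<gamma> :: 'a
  assumes len_commute: "len a b = len b a"
    and len_eq_null: "len a b = len c c \<Longrightarrow> a = b"
    and ext_T: "q \<noteq> a \<Longrightarrow> T q a (ext q a b c)"
    and ext_len: "q \<noteq> a \<Longrightarrow> len a (ext q a b c) = len b c"
    and five_segment: "\<lbrakk>a \<noteq> b; T a b c; T a' b' c'; len a b = len a' b'; len b c = len b' c';
      len a d = len a' d'; len b d = len b' d'\<rbrakk> \<Longrightarrow> len c d = len c' d'"
    and not_B_self: "\<not> B a b a"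
    and ip_T: "\<lbrakk>B a p c; T b q c; \<not> Col a b c\<rbrakk> \<Longrightarrow> T p (ip a p c b q) b \<and> T q (ip a p c b q) a"
    and frame: "\<not> Col \<alpha> \<beta> \<gamma>"
    and upper_dim: "\<lbrakk>a \<noteq> b; len p a = len p b; len q a = len q b; len r a = len r b\<rbrakk> \<Longrightarrow> Col p q r"
    and center_len: "\<not> Col a b c \<Longrightarrow>
      len a (center a b c) = len b (center a b c) \<and> len a (center a b c) = len c (center a b c)"
    and B_sym: "B a b c \<Longrightarrow> B c b a"
    and B_inner: "B a b d \<Longrightarrow> B b c d \<Longrightarrow> B a b c"
begin

section \<open>Betweenness and segment congruence, up to Gupta's connectivity theorem\<close>

lemma T_triv[simp]: "T a a b" "T a b b"
  by (auto simp: T_def)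

lemma T_sym: "T a b c \<longleftrightarrow> T c b a"
  using B_sym by (auto simp: T_def)

lemma T_antisym_self[simp]: "T a b a \<longleftrightarrow> a = b"
  using not_B_self by (auto simp: T_def)

lemma B_iff: "B a b c \<longleftrightarrow> T a b c \<and> a \<noteq> b \<and> b \<noteq> c"
proof -
  have "\<not> B b b c" for b c
    by (metis B_inner B_sym not_B_self)
  moreover have "\<not> B a b b" for a b
    by (metis B_inner B_sym not_B_self)
  ultimately show ?thesis by (auto simp: T_def)
qed

lemma T_inner: "T a b d \<Longrightarrow> T b c d \<Longrightarrow> T a b c"
  unfolding T_def using B_inner by (metis not_B_self)

lemma T_middle: "T a b c \<Longrightarrow> T a c d \<Longrightarrow> T b c d"
  by (metis T_inner T_sym)

lemma other_point: "\<exists>q. q \<noteq> (a :: 'a)"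
proof (rule ccontr)
  assume "\<not> ?thesis"
  then have "\<alpha> = a" "\<beta> = a" by blast+
  then show False using frame by (simp add: Col_def)
qed

lemma len_null: "len a a = len b b"
  by (metis ext_len len_eq_null other_point)

lemma len_null_iff[simp]: "len a b = len c c \<longleftrightarrow> a = b" "len c c = len a b \<longleftrightarrow> a = b"
  by (metis len_eq_null len_null)+

text \<open>The five-segment axiom with the fourth point equal to the first; null segments are
  congruent to each other.\<close>

lemma len_add:
  "\<lbrakk>T a b c; T a' b' c'; len a b = len a' b'; len b c = len b' c'\<rbrakk> \<Longrightarrow> len a c = len a' c'"
  using five_segment[of a b c a' b' c' a a'] len_null[of a a'] len_commute[of a b]
    len_commute[of a' b'] len_commute[of a c] len_commute[of a' c'] len_eq_null[of a' b' a]
  by (cases "a = b") auto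

lemma ext_unique: "\<lbrakk>q \<noteq> a; T q a x; T q a y; len a x = len a y\<rbrakk> \<Longrightarrow> x = y"
  by (metis five_segment len_add len_eq_null)

text \<open>Laying off \<open>cd\<close> beyond \<open>c\<close> from \<open>a\<close> gives a point
  that also extends \<open>bc\<close>, so by uniqueness of extension it is \<open>d\<close>.\<close>

lemma T_outer: assumes "T a b c" "T b c d" "b \<noteq> c" shows "T a c d"
proof (cases "a = c")
  case False
  define x where "x = ext a c c d"
  have x: "T a c x" "len c x = len c d"
    unfolding x_def using False ext_T ext_len by blast+
  have "T b c x" using assms x T_middle by blast
  then have "x = d" using x assms ext_unique by metis
  then show ?thesis using x by simp
qed (use assms in auto)

lemma T_outer': "\<lbrakk>T a b c; T b c d; b \<noteq> c\<rbrakk> \<Longrightarrow> T a b d"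
  by (metis T_outer T_sym)

lemma T_right: "T a b d \<Longrightarrow> T b c d \<Longrightarrow> T a c d"
  by (metis T_inner T_outer)

lemma T_left: "T a b c \<Longrightarrow> T a c d \<Longrightarrow> T a b d"
  by (metis T_right T_sym)

lemma T_eq: "T a b c \<Longrightarrow> T b a c \<Longrightarrow> a = b"
  by (metis T_inner T_antisym_self)

lemma Col_perm: "Col a b c \<longleftrightarrow> Col b a c" "Col a b c \<longleftrightarrow> Col a c b" "Col a b c \<longleftrightarrow> Col c a b"
  "Col a b c \<longleftrightarrow> Col b c a" "Col a b c \<longleftrightarrow> Col c b a"
  unfolding Col_def using T_sym by blast+

lemma Col_triv[simp]: "Col a a b" "Col a b a" "Col a b b"
  by (auto simp: Col_def)

lemma T_Col: "T a b c \<Longrightarrow> Col a b c"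
  by (auto simp: Col_def)

lemma T_Cols: assumes "T a b c"
  shows "Col a b c" "Col a c b" "Col b a c" "Col b c a" "Col c a b" "Col c b a"
  using T_Col[OF assms] Col_perm by blast+

text \<open>The collinear case, which the axiom excludes, needs only the transitivity of betweenness.\<close>

lemma inner_pasch:
  assumes "T a p c" "T b q c"
  obtains x where "T p x b" "T q x a"
proof -
  have "\<exists>x. T p x b \<and> T q x a"
  proof (cases "a = p \<or> p = c \<or> \<not> B a p c")
    case True
    then show ?thesis using assms T_sym T_triv by (metis T_def)
  next
    case False
    show ?thesis
    proof (cases "Col a b c")
      case True
      then consider "T c a b" | "T a c b" | "T a b c" by (auto simp: Col_def)
      then show ?thesis
      proof cases
        case 1 then show ?thesis using assms by (metis T_inner T_sym T_triv(2))
      next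
        case 2 then show ?thesis using assms by (metis T_inner T_sym)
      next
        case 3 then show ?thesis using assms by (metis T_inner T_sym T_triv(2))
      qed
    next
      case noncol: False
      show ?thesis using ip_T[OF _ assms(2) noncol] False by blast
    qed
  qed
  then show ?thesis using that by blast
qed

text \<open>\<open>ext\<close> is unspecified when its first two points coincide; in that case the
  segment is laid off starting from some other point.\<close>

lemma ext_exists: obtains x where "T a b x" "len b x = len c d"
proof (cases "a = b")
  case True
  obtain q where "q \<noteq> b" using other_point by blast
  then show ?thesis using that[of "ext q b c d"] True ext_T ext_len by auto
next
  case False
  then show ?thesis using that ext_T ext_len by blast
qed

lemma ext_exists_proper: obtains x where "T a b x" "b \<noteq> x"
proof -
  obtain q where "q \<noteq> b" using other_point by blast
  obtain x where "T a b x" "len b x = len b q" using ext_exists by blast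
  then show ?thesis using that \<open>q \<noteq> b\<close> by (metis len_null_iff(1) len_commute)
qed

text \<open>The five-segment axiom is applied twice: outwards to an auxiliary point \<open>e\<close>
  beyond \<open>c\<close>, then back from \<open>e\<close> over \<open>c\<close> to
  \<open>b\<close>.\<close>

lemma inner_five_segment:
  assumes "T a b c" "T a' b' c'" "len a c = len a' c'" "len b c = len b' c'"
    "len a d = len a' d'" "len c d = len c' d'"
  shows "len b d = len b' d'"
proof (cases "a = c")
  case True
  then have "a' = c'" using assms(3) by (metis len_eq_null)
  then show ?thesis using True assms by auto
next
  case False
  obtain e where e: "T a c e" "c \<noteq> e" using ext_exists_proper by blast
  obtain e' where e': "T a' c' e'" "len c' e' = len c e" using ext_exists by blast
  have ed: "len e d = len e' d'"
    using five_segment[OF False e(1) e'(1)] assms e' by metis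
  have "T e c b" "T e' c' b'" using assms e e' T_sym T_middle by metis+
  then show ?thesis
    using five_segment[of e c b e' c' b' d d'] e e' ed assms by (metis len_commute)
qed

lemma len_diff: "\<lbrakk>T a b c; T a' b' c'; len a c = len a' c'; len b c = len b' c'\<rbrakk> \<Longrightarrow> len a b = len a' b'"
  using inner_five_segment[of a b c a' b' c' a a'] len_null[of a a'] len_commute[of a b]
    len_commute[of a' b'] len_commute[of a c] len_commute[of a' c'] by simp

text \<open>Copies of \<open>ab\<close> and \<open>bc\<close> are laid off in succession from
  \<open>a'\<close>, away from an auxiliary point \<open>q\<close>; the total length forces the end
  to be \<open>c'\<close>.\<close>

lemma T_cong_exists:
  assumes "T a b c" "len a c = len a' c'"
  obtains b' where "T a' b' c'" "len a b = len a' b'" "len b c = len b' c'"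
proof -
  obtain q where q: "T c' a' q" "a' \<noteq> q" using ext_exists_proper by blast
  obtain b' where b': "T q a' b'" "len a' b' = len a b" using ext_exists by blast
  obtain c'' where c'': "T q b' c''" "len b' c'' = len b c" using ext_exists by blast
  have 1: "T a' b' c''" using b' c'' T_middle by blast
  have "len a' c'' = len a c" using len_add[OF 1 assms(1)] b' c'' by auto
  moreover have "T q a' c''" using b' c'' T_left by blast
  moreover have "T q a' c'" using q T_sym by blast
  ultimately have "c'' = c'" using ext_unique q assms by metis
  then show ?thesis using that 1 b' c'' by auto
qed

text \<open>The point \<open>x\<close> that divides \<open>a'c'\<close> as \<open>b\<close> divides
  \<open>ac\<close> has the same distances from \<open>a'\<close> and \<open>c'\<close> as
  \<open>b'\<close>, which makes \<open>xb'\<close> a null segment.\<close>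

lemma T_cong:
  assumes "T a b c" "len a b = len a' b'" "len a c = len a' c'" "len b c = len b' c'"
  shows "T a' b' c'"
proof -
  obtain x where x: "T a' x c'" "len a b = len a' x" "len b c = len x c'"
    using T_cong_exists assms by metis
  have "len x x = len x b'"
    using inner_five_segment[OF x(1) x(1) refl refl, of x b'] x assms by (metis len_commute)
  then have "x = b'" by simp
  then show ?thesis using x by simp
qed

lemma five_segment_Col:
  assumes "Col a b c" "len a b = len a' b'" "len a c = len a' c'" "len b c = len b' c'"
    "a \<noteq> b" "len a d = len a' d'" "len b d = len b' d'"
  shows "len c d = len c' d'"
proof -
  have ab: "a' \<noteq> b'" using assms(2,5) by (metis len_null_iff(1))
  have comm: "len b a = len b' a'" "len c a = len c' a'" "len c b = len c' b'"
    using assms(2-4) by (simp_all add: len_commute)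
  consider "T c a b" | "T a c b" | "T a b c" using assms by (auto simp: Col_def)
  then show ?thesis
  proof cases
    case 1
    then have "T c' a' b'" by (rule T_cong) (use assms comm in simp_all)
    then show ?thesis using 1 five_segment[of b a c b' a' c' d d'] assms comm T_sym[of c a b]
        T_sym[of c' a' b'] by simp
  next
    case 2
    then have "T a' c' b'" by (rule T_cong) (use assms comm in simp_all)
    then show ?thesis using 2 inner_five_segment[of a c b a' c' b' d d'] assms comm by simp
  next
    case 3
    then have "T a' b' c'" by (rule T_cong) (use assms comm in simp_all)
    then show ?thesis using 3 five_segment[of a b c a' b' c' d d'] assms by simp
  qed
qed

lemma equidistant_Col:
  "\<lbrakk>a \<noteq> b; Col a b c; len a p = len a q; len b p = len b q\<rbrakk> \<Longrightarrow> len c p = len c q"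
  using five_segment_Col[of a b c a b c p q] by simp

lemma equidistant_Col_unique:
  "\<lbrakk>a \<noteq> b; Col a b c; len a c = len a c'; len b c = len b c'\<rbrakk> \<Longrightarrow> c = c'"
  using equidistant_Col[of a b c c c'] by simp

lemma equidistant_T_unique:
  "\<lbrakk>T a c b; len a c = len a c'; len b c = len b c'\<rbrakk> \<Longrightarrow> c = c'"
  using equidistant_Col_unique[of a b c c'] T_Col[of a c b] Col_perm(2)[of a c b]
  by (cases "a = b") auto

text \<open>The proof is Gupta's.\<close>

lemma T_connected_outer:
  assumes ab: "a \<noteq> b" and abc: "T a b c" and abd: "T a b d"
  shows "T a c d \<or> T a d c"
proof (rule ccontr)
  assume neg: "\<not> ?thesis"
  obtain c' where c': "T a d c'" "len d c' = len c d" using ext_exists by blast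
  obtain d' where d': "T a c d'" "len c d' = len c d" using ext_exists by blast
  \<comment> \<open>\<open>b'\<close> and \<open>b''\<close> are reached from \<open>b\<close> by
    laying off the lengths of \<open>bc\<close>, \<open>cd\<close>, \<open>db\<close> in opposite
    orders, so they will coincide.\<close>
  obtain b' where b': "T a c' b'" "len c' b' = len c b" using ext_exists by blast
  obtain b'' where b'': "T a d' b''" "len d' b'' = len d b" using ext_exists by blast
  have cc': "c \<noteq> c'" using neg c' by auto
  have dd': "d \<noteq> d'" using neg d' by auto
  have bcd': "T b c d'" using abc d' T_middle by blast
  have bdc': "T b d c'" using abd c' T_middle by blast
  have acb'': "T a c b''" using d' b'' T_left by blast
  have adb': "T a d b'" using c' b' T_left by blast
  have dc'b': "T d c' b'" using c' b' T_middle by blast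
  have cd'b'': "T c d' b''" using d' b'' T_middle by blast
  have bd'b'': "T b d' b''" using abc d' b'' T_left T_middle by metis
  have bc'b': "T b c' b'" using abd c' b' T_left T_middle by metis
  have bc'_: "len b c' = len b'' c"
    using len_add[OF bdc', of b'' d' c] cd'b'' T_sym b'' d' c' by (metis len_commute)
  have bcb'': "T b c b''" using abc acb'' T_middle by blast
  have "len b b' = len b'' b"
    using len_add[OF bc'b', of b'' c b] bcb'' T_sym b' bc'_ by (metis len_commute)
  moreover have "T a b b'" "T a b b''" using abc abd acb'' adb' T_left by blast+
  ultimately have bb: "b'' = b'" using ext_unique[OF ab] by (metis len_commute)
  \<comment> \<open>\<open>cd\<close>, \<open>dc'\<close> and \<open>cd'\<close> are congruent by
    construction; this is the fourth side of the rhombus \<open>c d c' d'\<close>.\<close>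
  have d'c': "len d' c' = len d c"
  proof (cases "b = c")
    case True
    then have "T a c d" using abd by simp
    then show ?thesis using neg by simp
  next
    case False
    have 1: "T b' c' d" using dc'b' T_sym by blast
    have "len c' d = len c d'" using c' d' by (metis len_commute)
    moreover have "len b c = len b' c'" using b' by (metis len_commute)
    moreover have "len b c' = len b' c" using bc'_ bb by simp
    ultimately show ?thesis
      using five_segment[OF False bcd' 1, of c' c] by (metis len_commute)
  qed
  \<comment> \<open>\<open>e\<close> is the crossing of the diagonals of the rhombus, and turns out
    to bisect both.\<close>
  obtain e where e: "T c e c'" "T d e d'"
    using inner_pasch[of d' c b c' d] bcd' bdc' T_sym by metis
  have ec: "len e c = len e c'"
    using inner_five_segment[of d e d' d e d' c c'] e c' d' d'c' by (metis len_commute)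
  have ed: "len e d = len e d'"
    using inner_five_segment[of c e c' c e c' d d'] e c' d' d'c' by (metis len_commute)
  obtain p where p: "T c' c p" "len c p = len c d'" using ext_exists by blast
  obtain r where r: "T d' c r" "len c r = len c e" using ext_exists by blast
  obtain q where q: "T p r q" "len r q = len r p" using ext_exists by blast
  have cd': "c \<noteq> d'" using d' neg by (metis len_null_iff(1) T_triv(2))
  have cp: "c \<noteq> p" using p cd' by (metis len_null_iff(1))
  have pce: "T p c e" using e p T_sym T_inner by metis
  have "len r p = len e d'"
    using five_segment[of d' c r p c e p d'] cd' r pce p by (metis len_commute)
  then have rp: "len r p = len e d'" "len r q = len e d" using q ed by simp_all
  have ed': "e \<noteq> d'" using ed dd' by (metis len_null_iff(1) len_commute)
  have "len d c = len q c"
    using five_segment[of d' e d p r q c c] ed' e q rp r p T_sym by (metis len_commute)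
  then have cpq: "len c p = len c q" using p d' by (metis len_commute)
  \<comment> \<open>Equidistance from \<open>p\<close> and \<open>q\<close> spreads along lines:
    from \<open>r\<close> and \<open>c\<close> to \<open>d'\<close>, then to \<open>b\<close> and
    \<open>b'\<close>, then to \<open>c'\<close>, and finally to \<open>p\<close> itself.\<close>
  have rpr: "p \<noteq> q \<Longrightarrow> False"
  proof -
    assume pq: "p \<noteq> q"
    have rpq: "len r p = len r q" using q by simp
    have rc: "r \<noteq> c"
    proof
      assume "r = c"
      then have "c = e" using r by (metis len_null_iff(1))
      then show False using ec cc' by (metis len_null_iff(2))
    qed
    have "len d' p = len d' q"
      using equidistant_Col[of r c d' p q] rc r rpq cpq T_Col Col_perm by metis
    then have "len b p = len b q" "len b' p = len b' q"
      using equidistant_Col[of c d' _ p q] cd' bcd' cd'b'' bb cpq T_Col Col_perm by metis+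
    moreover have "b \<noteq> b' \<Longrightarrow> Col b b' c'" using bc'b' T_Col Col_perm by metis
    moreover have "b \<noteq> b'" using bcb'' bb abd neg \<open>T a b b'\<close>
      by (metis T_antisym_self adb' T_eq T_sym)
    ultimately have "len c' p = len c' q" using equidistant_Col by blast
    then have "len p p = len p q"
      using equidistant_Col[of c' c p p q] cc' p cpq T_Col Col_perm by metis
    then show False using pq by simp
  qed
  then have "p = q" by blast
  then have "r = p" using q by auto
  then have "e = d'" using rp by (metis len_null_iff(1))
  then show False using ed' by simp
qed

subsection \<open>Lines, point reflections and right angles\<close>

lemma T_connected: "\<lbrakk>a \<noteq> b; T a b c; T a b d\<rbrakk> \<Longrightarrow> T b c d \<or> T b d c"
  using T_connected_outer T_middle by blast

lemma T_connected_inner: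
  assumes "T a b d" "T a c d"
  shows "T a b c \<or> T a c b"
proof -
  obtain p where "T d a p" "a \<noteq> p" using ext_exists_proper by blast
  moreover from this have "T p a b" "T p a c" using assms T_sym T_inner by blast+
  ultimately show ?thesis using T_connected[of p a b c] by blast
qed

lemma Col_trans:
  assumes "a \<noteq> b" "Col a b c" "Col a b d"
  shows "Col a c d"
proof -
  have 1: ?thesis if "T c a b" "T d a b"
    using T_connected[of b a c d] that assms(1) T_sym[of c a b] T_sym[of d a b]
    unfolding Col_def by auto
  have 2: "Col a x y" if "T x a b" "T a y b" for x y
    using T_inner[OF that] T_sym[of x a y] unfolding Col_def by auto
  have 3: "Col a x y" if "T x a b" "T a b y" for x y
    using T_outer'[OF that assms(1)] T_sym[of x a y] unfolding Col_def by auto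
  have 4: ?thesis if "T a c b" "T a d b"
    using T_connected_inner[OF that] unfolding Col_def by auto
  have 5: "Col a x y" if "T a x b" "T a b y" for x y
    using T_left[OF that] unfolding Col_def by auto
  have 6: ?thesis if "T a b c" "T a b d"
    using T_connected_outer[OF assms(1) that] unfolding Col_def by auto
  have "T c a b \<or> T a c b \<or> T a b c" "T d a b \<or> T a d b \<or> T a b d"
    using assms by (auto simp: Col_def)
  then show ?thesis
    using 1 2[of c d] 2[of d c] 3[of c d] 3[of d c] 4 5[of c d] 5[of d c] 6 Col_perm(2)[of a d c]
    by argo
qed

lemma Col_trans3: "\<lbrakk>p \<noteq> q; Col p q a; Col p q b; Col p q c\<rbrakk> \<Longrightarrow> Col a b c"
  by (metis Col_perm(2,3) Col_trans Col_triv(1))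

definition line :: "'a \<Rightarrow> 'a \<Rightarrow> 'a set" where
  "line a b = {x. Col a b x}"

definition is_line :: "'a set \<Rightarrow> bool" where
  "is_line L \<longleftrightarrow> (\<exists>a b. a \<noteq> b \<and> L = line a b)"

lemma in_line[simp]: "x \<in> line a b \<longleftrightarrow> Col a b x"
  by (simp add: line_def)

lemma is_lineI[simp]: "a \<noteq> b \<Longrightarrow> is_line (line a b)"
  by (auto simp: is_line_def)

lemma line_Col: "\<lbrakk>is_line L; a \<in> L; b \<in> L; c \<in> L\<rbrakk> \<Longrightarrow> Col a b c"
  by (auto simp: is_line_def intro: Col_trans3)

lemma line_in: "\<lbrakk>is_line L; a \<in> L; b \<in> L; a \<noteq> b; Col a b c\<rbrakk> \<Longrightarrow> c \<in> L"
proof -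
  assume *: "is_line L" "a \<in> L" "b \<in> L" "a \<noteq> b" "Col a b c"
  then obtain p q where pq: "p \<noteq> q" "L = line p q" by (auto simp: is_line_def)
  then have "Col a b p" "Col a b q"
    using * Col_trans3[of p q a b p] Col_trans3[of p q a b q] by auto
  then show ?thesis using * pq Col_trans3[of a b p q c] by simp
qed

lemma line_eq: "\<lbrakk>is_line L; a \<in> L; b \<in> L; a \<noteq> b\<rbrakk> \<Longrightarrow> L = line a b"
  by (auto intro: line_Col line_in)

lemma lines_eq: "\<lbrakk>is_line L; is_line M; a \<in> L; b \<in> L; a \<in> M; b \<in> M; a \<noteq> b\<rbrakk> \<Longrightarrow> L = M"
  using line_eq by metis

lemma line_other: "is_line L \<Longrightarrow> \<exists>y \<in> L. y \<noteq> x"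
  by (metis Col_triv(2,3) in_line is_line_def)

lemma line_exists: "\<exists>L. is_line L \<and> a \<in> L \<and> b \<in> L"
proof (cases "a = b")
  case True
  then show ?thesis using other_point[of a] by (metis in_line is_lineI Col_triv(1,2))
next
  case False
  then show ?thesis by (intro exI[of _ "line a b"]) simp
qed

text \<open>The center is treated separately because \<open>ext m m m m\<close> is
  unspecified.\<close>

definition reflect :: "'a \<Rightarrow> 'a \<Rightarrow> 'a" where
  "reflect m x = (if x = m then m else ext x m m x)"

lemma reflect_T: "T x m (reflect m x)"
  by (simp add: reflect_def ext_T)

lemma reflect_len: "len m (reflect m x) = len m x"
  by (simp add: reflect_def ext_len)

lemma reflect_self[simp]: "reflect m m = m"
  by (simp add: reflect_def)

lemma reflect_unique: "T x m y \<Longrightarrow> len m y = len m x \<Longrightarrow> y = reflect m x"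
  using ext_unique[of x m y "reflect m x"] reflect_T reflect_len by (cases "x = m") auto

lemma reflect_reflect[simp]: "reflect m (reflect m x) = x"
  using reflect_unique[of "reflect m x" m x] reflect_T T_sym reflect_len by metis

lemma reflect_eq_iff: "reflect m x = x \<longleftrightarrow> x = m" "x = reflect m x \<longleftrightarrow> x = m" "reflect m x = m \<longleftrightarrow> x = m"
proof -
  show 1: "reflect m x = x \<longleftrightarrow> x = m" using reflect_T[of x m] by auto
  then show "x = reflect m x \<longleftrightarrow> x = m" by metis
  show "reflect m x = m \<longleftrightarrow> x = m" using reflect_reflect[of m x] by (metis reflect_self)
qed

lemma reflect_inj: "reflect m x = reflect m y \<longleftrightarrow> x = y"
  by (metis reflect_reflect)

lemma reflect_Col: "Col x m (reflect m x)"
  using reflect_T T_Col by blast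

lemma reflect_in_line: "\<lbrakk>is_line L; m \<in> L; x \<in> L\<rbrakk> \<Longrightarrow> reflect m x \<in> L"
  using line_in[of L x m] reflect_Col by (cases "x = m") auto

lemma reflect_in_line_iff: "\<lbrakk>is_line L; m \<in> L\<rbrakk> \<Longrightarrow> reflect m x \<in> L \<longleftrightarrow> x \<in> L"
  using reflect_in_line reflect_reflect by metis

text \<open>All four arms are extended to the common length \<open>mp + mq\<close>, giving
  \<open>x\<close>, \<open>y\<close>, \<open>x'\<close>, \<open>y'\<close> equidistant from
  \<open>m\<close>. The five-segment axiom compares \<open>xy\<close> with \<open>x'y'\<close>; its
  inner form then brings the congruence back to \<open>qx\<close> and to \<open>pq\<close>.\<close>

lemma reflect_isometry: "len (reflect m p) (reflect m q) = len p q"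
proof (cases "p = m")
  case True
  then show ?thesis by (simp add: reflect_len)
next
  case pm: False
  show ?thesis
  proof (cases "q = m")
    case True
    then show ?thesis using reflect_len by (simp add: len_commute)
  next
    case qm: False
    define p' q' where "p' = reflect m p" and "q' = reflect m q"
    have p': "T p m p'" "len m p' = len m p" and q': "T q m q'" "len m q' = len m q"
      unfolding p'_def q'_def using reflect_T reflect_len by blast+
    have p'm: "p' \<noteq> m" and q'm: "q' \<noteq> m" using pm qm by (simp_all add: p'_def q'_def reflect_eq_iff)
    obtain x where x: "T p' p x" "len p x = len q m" using ext_exists by blast
    obtain x' where x': "T x p' x'" "len p' x' = len q m" using ext_exists by blast
    obtain y where y: "T q' q y" "len q y = len p m" using ext_exists by blast
    obtain y' where y': "T y q' y'" "len q' y' = len p m" using ext_exists by blast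
    have mpx: "T m p x" using p' x T_sym T_middle by metis
    have mqy: "T m q y" using q' y T_sym T_middle by metis
    have xmp': "T x m p'" using p' x T_sym T_left by metis
    have ymq': "T y m q'" using q' y T_sym T_left by metis
    have mp'x': "T m p' x'" using xmp' x' T_middle by blast
    have mq'y': "T m q' y'" using ymq' y' T_middle by blast
    have xmx': "T x m x'" using xmp' x' T_left by blast
    have ymy': "T y m y'" using ymq' y' T_left by blast
    have "T y q m" using mqy T_sym by blast
    then have mxy: "len m x = len m y"
      using len_add[OF mpx, of y q m] x y by (metis len_commute)
    have mxx': "len m x' = len m x"
      using len_add[OF mp'x' mpx] p' x x' by metis
    have myy': "len m y' = len m y"
      using len_add[OF mq'y' mqy] q' y y' by metis
    have xm: "x \<noteq> m" using mpx pm by auto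
    have "T y' m y" using ymy' T_sym by blast
    then have x'y': "len x' y' = len y x"
      using five_segment[OF xm xmx', of y' m y y' x] mxy mxx' myy' by (metis len_commute)
    have qx: "len q x = len q' x'"
      using inner_five_segment[of y q m y' q' m x x'] mqy mq'y' T_sym mxy mxx' myy' x'y' q'
      by (metis len_commute)
    have "len p q = len p' q'"
      using inner_five_segment[of x p m x' p' m q q'] mpx mp'x' T_sym mxy mxx' x x' qx q' p'
      by (metis len_commute)
    then show ?thesis by (simp add: p'_def q'_def)
  qed
qed

lemma reflect_T_iff: "T (reflect m a) (reflect m b) (reflect m c) \<longleftrightarrow> T a b c"
  using T_cong reflect_isometry by (metis reflect_reflect)

lemma reflect_Col_iff: "Col (reflect m a) (reflect m b) (reflect m c) \<longleftrightarrow> Col a b c"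
  unfolding Col_def using reflect_T_iff by blast

lemma reflect_swap: "len (reflect m a) b = len a (reflect m b)"
  using reflect_isometry[of m a "reflect m b"] by simp

lemma midpoint_Col:
  assumes "Col a m b" "len m a = len m b" "a \<noteq> b"
  shows "b = reflect m a"
proof -
  consider "T b a m" | "T a b m" | "T a m b" using assms by (auto simp: Col_def)
  then show ?thesis
  proof cases
    case 1
    have "b = a"
      using len_diff[of a a m b a m] len_diff[OF 1, of a a m] assms
      by (metis T_triv(1) len_null_iff(1) len_commute)
    then show ?thesis using assms by simp
  next
    case 2
    have "b = a"
      using len_diff[OF 2, of b b m] assms
      by (metis T_triv(1) len_null_iff(1) len_commute)
    then show ?thesis using assms by simp
  next
    case 3
    then show ?thesis using reflect_unique assms by metis
  qed
qed

text \<open>Unlike \<open>RightAngle\<close>, this includes the degenerate cases in which an arm is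
  null, so that \<open>perp\<close> can quantify over all points of both lines.\<close>

definition Per :: "'a \<Rightarrow> 'a \<Rightarrow> 'a \<Rightarrow> bool" where
  "Per a b c \<longleftrightarrow> len a c = len a (reflect b c)"

lemma Per_sym: "Per a b c \<longleftrightarrow> Per c b a"
  unfolding Per_def by (metis reflect_swap len_commute)

lemma Per_triv[simp]: "Per a b b" "Per b b a"
  by (auto simp: Per_def reflect_len)

lemma Per_Col: "\<lbrakk>Per a b c; a \<noteq> b; Col b a a'\<rbrakk> \<Longrightarrow> Per a' b c"
  unfolding Per_def using equidistant_Col[of a b a' c "reflect b c"] reflect_len Col_perm by metis

lemma Per_self: "Per a b a \<Longrightarrow> a = b"
  unfolding Per_def by (metis len_null_iff(2) reflect_eq_iff(2))

text \<open>The mirror image \<open>c'\<close> of \<open>c\<close> in \<open>b\<close> would have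
  the same distances as \<open>c\<close> from both \<open>a\<close> and \<open>reflect c a\<close>.
  Since \<open>c\<close> lies between these two points, the distances determine it.\<close>

lemma Per_Per: 
  assumes "Per a b c" "Per a c b"
  shows "b = c"
proof (rule ccontr)
  assume bc: "b \<noteq> c"
  define c' a' where "c' = reflect b c" and "a' = reflect c a"
  have "Col c b c'" unfolding c'_def using reflect_Col by blast
  then have "Per c' c a" using Per_Col assms(2) Per_sym bc by blast
  then have 1: "len c' a = len c' a'" by (simp add: Per_def a'_def)
  have 2: "len a c = len a c'" using assms(1) by (simp add: Per_def c'_def)
  have "len a' c = len a' c'" using 1 2 reflect_len by (metis a'_def len_commute)
  then have "c = c'" using equidistant_T_unique[of a c a' c'] 2 reflect_T a'_def by metis
  then show False using bc by (simp add: c'_def reflect_eq_iff)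
qed

lemma Per_cong:
  assumes "Per a b c" "len a b = len a' b'" "len a c = len a' c'" "len b c = len b' c'"
  shows "Per a' b' c'"
proof (cases "b = c")
  case True
  then have "b' = c'" using assms by (metis len_null_iff(2))
  then show ?thesis by simp
next
  case False
  have "len (reflect b c) a = len (reflect b' c') a'"
    by (rule five_segment[of c b _ c' b']) (use False assms reflect_T reflect_len in \<open>simp_all add: len_commute\<close>)
  then show ?thesis using assms by (simp add: Per_def len_commute)
qed

section \<open>Perpendicular lines in the plane\<close>

definition perp :: "'a set \<Rightarrow> 'a set \<Rightarrow> 'a \<Rightarrow> bool" where
  "perp L M x \<longleftrightarrow> is_line L \<and> is_line M \<and> x \<in> L \<and> x \<in> M \<and> (\<forall>l\<in>L. \<forall>m\<in>M. Per l x m)"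

lemma perpI:
  assumes "is_line L" "is_line M" "x \<in> L" "x \<in> M" "l \<in> L" "m \<in> M" "l \<noteq> x" "m \<noteq> x" "Per l x m"
  shows "perp L M x"
proof -
  have "Per l' x m'" if "l' \<in> L" "m' \<in> M" for l' m'
  proof -
    have "Per l' x m" using Per_Col[OF assms(9,7)] that assms line_Col by blast
    then show ?thesis using Per_Col[of m x l' m'] that assms line_Col Per_sym by blast
  qed
  then show ?thesis using assms by (simp add: perp_def)
qed

lemma perp_meet: "\<lbrakk>perp L M x; y \<in> L; y \<in> M\<rbrakk> \<Longrightarrow> y = x"
  unfolding perp_def using Per_self by blast

lemma equidistant_line: "\<lbrakk>is_line L; a \<in> L; b \<in> L; a \<noteq> b; len a p = len a q; len b p = len b q; c \<in> L\<rbrakk>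
   \<Longrightarrow> len c p = len c q"
  using equidistant_Col line_Col by metis

text \<open>The converse of \<open>equidistant_line\<close>; it depends on planarity through
  \<open>upper_dim\<close>.\<close>

lemma equidistant_in_line: "\<lbrakk>is_line L; a \<in> L; b \<in> L; a \<noteq> b; len a p = len a q; len b p = len b q; p \<noteq> q;
  len c p = len c q\<rbrakk> \<Longrightarrow> c \<in> L"
  using upper_dim[of p q a b c] line_in by blast

text \<open>In the plane the perpendicular at a point is the locus of points equidistant from
  two points symmetric about it.\<close>

lemma perp_unique_at:
  assumes "perp L M x" "perp L N x"
  shows "M = N"
proof -
  obtain l where l: "l \<in> L" "l \<noteq> x" using assms line_other[of L x] unfolding perp_def by blast
  have "m \<in> N" if h: "perp L M x" "perp L N x" "m \<in> M" for M N m
  proof -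
    obtain n where n: "n \<in> N" "n \<noteq> x" using h line_other[of N x] unfolding perp_def by blast
    have "Per n x l" "Per m x l" "Per x x l" using h n l unfolding perp_def by (auto simp: Per_sym)
    then show ?thesis
      using equidistant_in_line[of N n x l "reflect x l" m] h n l reflect_eq_iff(2)[of l x]
      unfolding Per_def perp_def by blast
  qed
  then show ?thesis using assms by blast
qed

definition foot_of :: "'a set \<Rightarrow> 'a \<Rightarrow> 'a \<Rightarrow> bool" where
  "foot_of L c x \<longleftrightarrow> c \<notin> L \<and> perp L (line x c) x"

lemma foot_of_I:
  assumes "is_line L" "c \<notin> L" "x \<in> L" "l \<in> L" "l \<noteq> x" "Per c x l"
  shows "foot_of L c x"
proof -
  have "x \<noteq> c" using assms by auto
  then show ?thesis unfolding foot_of_def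
    using assms perpI[of L "line x c" x l c] Per_sym by auto
qed

subsection \<open>Dropping perpendiculars\<close>

text \<open>Both legs are prolonged beyond the base by the non-null length
  \<open>\<alpha>\<beta>\<close>. The inner \<open>ip\<close> is the crossing of the two diagonals
  thus obtained; the line from the apex \<open>c\<close> through it meets the base in its
  midpoint.\<close>

definition isosceles_mid :: "'a \<Rightarrow> 'a \<Rightarrow> 'a \<Rightarrow> 'a" where
  "isosceles_mid c a b =
    ip c a (ext c a \<alpha> \<beta>) b (ip (ext c a \<alpha> \<beta>) a c (ext c b \<alpha> \<beta>) b)"

lemma isosceles_mid:
  assumes "\<not> Col c a b" "len c a = len c b"
  shows "reflect (isosceles_mid c a b) a = b"
proof -
  have ab: "\<alpha> \<noteq> \<beta>" using frame by (auto simp: Col_def)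
  have ne: "c \<noteq> a" "c \<noteq> b" "a \<noteq> b" using assms by auto
  define p q where "p = ext c a \<alpha> \<beta>" and "q = ext c b \<alpha> \<beta>"
  have p: "T c a p" "len a p = len \<alpha> \<beta>" and q: "T c b q" "len b q = len \<alpha> \<beta>"
    unfolding p_def q_def using ext_T ext_len ne by blast+
  have ap: "a \<noteq> p" using p(2) ab len_eq_null by metis
  have bq: "b \<noteq> q" using q(2) ab len_eq_null by metis
  have cp: "c \<noteq> p" and cq: "c \<noteq> q" using p q ap bq ne by auto
  define L M where "L = line c a" and "M = line c b"
  have LM: "is_line L" "is_line M" "c \<in> L" "a \<in> L" "p \<in> L" "c \<in> M" "b \<in> M" "q \<in> M"
    unfolding L_def M_def using ne T_Col[OF p(1)] T_Col[OF q(1)] by simp_all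
  have "L \<noteq> M" using assms(1) L_def LM by auto
  then have meet: "x = c" if "x \<in> L" "x \<in> M" for x using that LM lines_eq by blast
  have bL: "b \<notin> L" and qL: "q \<notin> L" and aM: "a \<notin> M" and pM: "p \<notin> M"
    using meet LM ne cp cq by metis+
  have pqc: "\<not> Col p q c" using line_in[OF LM(1,5,3)] cp qL Col_perm(2) by metis
  have cbp: "\<not> Col c b p" using line_in[OF LM(1,3,5)] cp bL Col_perm(2) by metis
  define r where "r = ip p a c q b"
  have "B p a c" "T q b c"
    using B_iff[of p a c] p q ap ne T_sym[of c a p] T_sym[of c b q] by auto
  then have r: "T a r q" "T b r p" unfolding r_def using ip_T pqc by blast+
  define x where "x = ip c a p b r"
  have "B c a p" using B_iff[of c a p] p ap ne by auto
  then have x: "T a x b" "T r x c" unfolding x_def using ip_T[OF _ r(2) cbp] by blast+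
  have apbq: "len a p = len b q" using p q by simp
  have pb: "len p b = len q a"
    using five_segment[OF ne(1) p(1) q(1) assms(2) apbq, of b a] assms(2) len_commute by metis
  have aqbp: "len a q = len b p" using pb len_commute by metis
  obtain r' where r': "T b r' p" "len a r = len b r'" "len r q = len r' p"
    using T_cong_exists[OF r(1) aqbp] by blast
  have qb: "len q b = len p a" using apbq len_commute by metis
  have rb: "len r b = len r' a"
    by (rule inner_five_segment[OF r(1) r'(1)]) (use aqbp r' qb len_commute in auto)
  have rp: "len r p = len r' q"
    by (rule inner_five_segment[OF r(1) r'(1)]) (use aqbp r' apbq len_commute in auto)
  have "T a r' q"
    by (rule T_cong[OF r(2)]) (use rb rp aqbp len_commute in metis)+
  then have "r' \<in> line a q" "r' \<in> line b p" "r \<in> line a q" "r \<in> line b p"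
    using r r' by (auto intro: T_Cols)
  moreover have "a \<noteq> q" "b \<noteq> p" using qL LM bL by auto
  moreover have "line a q \<noteq> line b p"
  proof
    assume "line a q = line b p"
    then have "p \<in> line a q" "a \<in> line a q" by auto
    moreover have "is_line (line a q)" using \<open>a \<noteq> q\<close> by simp
    ultimately have "line a q = L" using lines_eq LM ap by blast
    then show False using qL in_line Col_triv(3) by metis
  qed
  ultimately have "r = r'" using lines_eq is_lineI by metis
  then have ra: "len r a = len r b" using rb by simp
  have "r \<noteq> c"
  proof
    assume "r = c"
    then have "T c b p" using r(2) ne T_connected_inner
      using pM LM(6,7) T_Col line_in[OF LM(2,7,6)] by metis
    then show False using cbp T_Col by blast
  qed
  then have "len x a = len x b"
    using equidistant_Col[of r c x a b] ra assms(2) T_Col[OF x(2)] Col_perm(2) by blast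
  then have "reflect x a = b" using reflect_unique[OF x(1)] by simp
  then show ?thesis by (simp add: isosceles_mid_def x_def r_def p_def q_def)
qed

lemma off_line: assumes "is_line L" shows "\<exists>x. x \<notin> L"
  using frame line_Col[OF assms] by blast

text \<open>The circumcenter of \<open>a\<close>, \<open>b\<close> and any third point off their
  line serves as an apex equidistant from \<open>a\<close> and \<open>b\<close>. It is either the
  midpoint itself or spans an isosceles triangle over \<open>ab\<close>.\<close>

lemma midpoint_exists: obtains m where "reflect m a = b"
proof (cases "a = b")
  case True
  then show ?thesis using that[of a] by simp
next
  case False
  obtain w where w: "\<not> Col a b w" using off_line[of "line a b"] False by auto
  define z where "z = center a b w"
  have z: "len z a = len z b" using center_len[OF w] len_commute unfolding z_def by metis
  show ?thesis
  proof (cases "Col z a b")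
    case True
    then show ?thesis using that midpoint_Col[of a z b] z False Col_perm(1) by metis
  next
    case False
    then show ?thesis using that isosceles_mid z by blast
  qed
qed

text \<open>Gupta's construction; in the plane, the upper dimension axiom replaces the Krippenlemma in
  its verification.\<close>

definition foot :: "'a \<Rightarrow> 'a \<Rightarrow> 'a \<Rightarrow> 'a" where
  "foot a b c =
    (let y = ext b a a c; p = isosceles_mid a c y; z = ext a y y p; q = ext p y y a;
         q' = ext q z z q; c' = ext q' y y c
     in isosceles_mid y c c')"

lemma foot_of_foot:
  assumes "\<not> Col a b c"
  shows "foot_of (line a b) c (foot a b c)"
proof -
  define L where "L = line a b"
  have ab: "a \<noteq> b" using assms by auto
  have L: "is_line L" "a \<in> L" "b \<in> L" "c \<notin> L" unfolding L_def using assms ab by auto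
  have ac: "a \<noteq> c" using L by auto
  \<comment> \<open>\<open>y\<close> makes \<open>a c y\<close> isosceles with \<open>y\<close> on
    \<open>L\<close>, so the line from \<open>a\<close> to the midpoint \<open>p\<close> of
    \<open>cy\<close> gives a right angle at \<open>p\<close>.\<close>
  define y where "y = ext b a a c"
  have y: "T b a y" "len a y = len a c" unfolding y_def using ab ext_T ext_len by metis+
  have ay: "a \<noteq> y" using y ac len_null_iff by metis
  have yL: "y \<in> L" using line_in[OF L(1,3,2)] ab y T_Col by blast
  have cy: "c \<noteq> y" using L yL by auto
  define p where "p = isosceles_mid a c y"
  have "\<not> Col a c y" using line_in[OF L(1,2) yL ay] L Col_perm(2) by blast
  then have p: "reflect p c = y" unfolding p_def using isosceles_mid y by metis
  have pT: "T c p y" and plen: "len p c = len p y" using p reflect_T reflect_len by metis+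
  have yp: "y \<noteq> p" using p cy reflect_eq_iff by metis
  have pL: "p \<notin> L"
    using line_in[OF L(1) yL _ yp, of c] L Col_perm T_Col[OF pT] by metis
  \<comment> \<open>The triangle \<open>y z q\<close> is a copy of \<open>y p a\<close> in the
    vertical angle at \<open>y\<close> with the roles of the two lines exchanged. The right angle at
    \<open>p\<close> is thereby moved to \<open>z\<close> on \<open>L\<close>.\<close>
  define z where "z = ext a y y p"
  have z: "T a y z" "len y z = len y p" unfolding z_def using ay ext_T ext_len by blast+
  have yz: "y \<noteq> z" using z yp len_null_iff by metis
  have zL: "z \<in> L" using line_in[OF L(1,2) yL ay] z T_Col by blast
  define q where "q = ext p y y a"
  have q: "T p y q" "len y q = len y a" unfolding q_def using yp ext_T ext_len by metis+
  have yq: "y \<noteq> q" using q ay len_null_iff by metis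
  define K where "K = line y c"
  have K: "is_line K" "y \<in> K" "c \<in> K" "p \<in> K" unfolding K_def
    using cy T_Col[OF pT] Col_perm by auto
  have qK: "q \<in> K" using line_in[OF K(1,4,2)] yp q T_Col by blast
  have KL: "x = y" if "x \<in> K" "x \<in> L" for x using that lines_eq[OF K(1) L(1)] K L yL by blast
  have zq: "z \<noteq> q" using KL zL qK yz by blast
  define q' where "q' = ext q z z q"
  have q': "q' = reflect z q" unfolding q'_def reflect_def using zq by auto
  have "Per a p y" unfolding Per_def using y p reflect_reflect by metis
  moreover have "len z q = len p a"
    using five_segment[of a y z q y p q a] ay z q pT T_sym len_commute by metis
  ultimately have "Per q z y"
    using Per_cong[of a p y q z y] q z len_commute by metis
  then have yqq': "len y q = len y q'" unfolding q' using Per_sym Per_def by blast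
  have yq': "q' \<noteq> y" using yqq' yq len_null_iff by metis
  \<comment> \<open>\<open>q\<close> and \<open>q'\<close> are mirror images in \<open>L\<close>;
    prolonging \<open>q'y\<close> as \<open>qy\<close> is prolonged to \<open>c\<close> makes
    \<open>c'\<close> the mirror image of \<open>c\<close>.\<close>
  define c' where "c' = ext q' y y c"
  have c': "T q' y c'" "len y c' = len y c" unfolding c'_def using yq' ext_T ext_len by blast+
  have qyc: "T q y c" using q pT T_outer yp T_sym by metis
  have ycc': "\<not> Col y c c'"
  proof
    assume "Col y c c'"
    then have "c' \<in> K" by (simp add: K_def)
    moreover have "y \<noteq> c'" using c' cy len_null_iff by metis
    ultimately have "q' \<in> K" using line_in[OF K(1,2)] c' T_Col Col_perm by metis
    moreover have "q \<noteq> q'" unfolding q' using zq reflect_eq_iff by metis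
    ultimately have "z \<in> K" using line_in[OF K(1) qK, of q'] q' reflect_Col Col_perm by metis
    then show False using KL zL yz by blast
  qed
  have zc: "len c z = len c' z"
    using five_segment[of q y c q' y c' z z] yq[symmetric] qyc c' yqq' q' reflect_len len_commute
    by metis
  define x where "x = isosceles_mid y c c'"
  have x: "reflect x c = c'" unfolding x_def using isosceles_mid[OF ycc'] c' by metis
  have cc': "c \<noteq> c'" using ycc' by auto
  have eq: "len l c = len l c'" if "l \<in> L" for l
    using equidistant_line[OF L(1) yL zL yz _ _ that] c' zc len_commute by metis
  have xL: "x \<in> L" 
    using equidistant_in_line[OF L(1) yL zL yz eq[OF yL] eq[OF zL] cc'] x reflect_len by metis
  obtain l where l: "l \<in> L" "l \<noteq> x" using line_other L by metis
  have "Per c x l" using eq[OF l(1)] x Per_sym Per_def by metis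
  then have "foot_of L c x" using foot_of_I L xL l by blast
  then show ?thesis
    by (simp add: foot_def Let_def L_def x_def y_def p_def z_def q_def q'_def c'_def)
qed

lemma foot_exists: "\<lbrakk>is_line L; c \<notin> L\<rbrakk> \<Longrightarrow> \<exists>x. foot_of L c x"
  unfolding is_line_def using foot_of_foot in_line by blast

text \<open>If \<open>M\<close> were not perpendicular to \<open>G\<close>, the circumcenter of a point of \<open>G\<close> and its two
  mirror images would be a common point of \<open>L\<close> and \<open>M\<close>.\<close>

lemma perp_disjoint_line:
  assumes L: "perp L G f" and M: "is_line M" "g \<in> M" "g \<in> G" and disj: "L \<inter> M = {}"
  shows "perp M G g"
proof (rule ccontr)
  assume neg: "\<not> ?thesis"
  have G: "is_line G" "f \<in> G" and L': "is_line L" "f \<in> L" using L by (auto simp: perp_def)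
  have fg: "f \<noteq> g" using disj M L' by auto
  define p where "p = reflect g f"
  have p: "p \<in> G" "p \<noteq> g" "p \<noteq> f"
    unfolding p_def using reflect_in_line G M fg by (auto simp: reflect_eq_iff)
  have pM: "p \<notin> M" using lines_eq[OF M(1) G(1), of g p] M p G L' disj by auto
  define p' where "p' = reflect f p"
  have p': "p' \<in> G" "p \<noteq> p'" unfolding p'_def using reflect_in_line G p by (auto simp: reflect_eq_iff)
  obtain h where h: "foot_of M p h" using foot_exists M pM by blast
  have hM: "perp M (line h p) h" using h by (simp add: foot_of_def)
  have hp: "h \<noteq> p" "h \<in> M" using hM pM by (auto simp: perp_def)
  define p'' where "p'' = reflect h p"
  have p'': "p \<noteq> p''" unfolding p''_def using hp by (simp add: reflect_eq_iff)
  have "\<not> Col p p' p''"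
  proof
    assume "Col p p' p''"
    then have "p'' \<in> G" using line_in[OF G(1) p(1) p'(1,2)] by blast
    then have hG: "h \<in> G"
      using line_in[OF G(1) p(1) _ p''] reflect_Col Col_perm(2) unfolding p''_def by metis
    then have "h = g" using lines_eq[OF M(1) G(1), of g h] M hp pM p by blast
    moreover have "line h p = G" using line_eq[OF G(1) hG p(1) hp(1)] by simp
    ultimately show False using hM neg by simp
  qed
  define z where "z = center p p' p''"
  have z: "len z p = len z p'" "len z p = len z p''"
    unfolding z_def using center_len[OF \<open>\<not> Col p p' p''\<close>] len_commute by metis+
  obtain l where l: "l \<in> L" "l \<noteq> f" using line_other L' by metis
  have "len l p = len l p'" "len f p = len f p'"
    using L l L' p unfolding perp_def p'_def Per_def by auto
  then have "z \<in> L" using equidistant_in_line[OF L'(1) l(1) L'(2) l(2)] p'(2) z by blast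
  moreover
  obtain m where m: "m \<in> M" "m \<noteq> h" using line_other M by metis
  have "len m p = len m p''" "len h p = len h p''"
    using hM m hp unfolding perp_def p''_def Per_def by auto
  then have "z \<in> M" using equidistant_in_line[OF M(1) m(1) hp(2) m(2)] p'' z by blast
  ultimately show False using disj by blast
qed

subsection \<open>The sides of a line\<close>

definition opp :: "'a set \<Rightarrow> 'a \<Rightarrow> 'a \<Rightarrow> bool" where
  "opp L a b \<longleftrightarrow> a \<notin> L \<and> b \<notin> L \<and> (\<exists>t\<in>L. T a t b)"

definition out :: "'a \<Rightarrow> 'a \<Rightarrow> 'a \<Rightarrow> bool" where
  "out z a b \<longleftrightarrow> a \<noteq> z \<and> b \<noteq> z \<and> (T z a b \<or> T z b a)"

lemma opp_sym: "opp L a b \<longleftrightarrow> opp L b a"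
  unfolding opp_def using T_sym by blast

lemma out_sym: "out z a b \<longleftrightarrow> out z b a"
  unfolding out_def by blast

lemma out_trans: assumes "out z a b" "out z b c" shows "out z a c"
proof -
  have ne: "a \<noteq> z" "b \<noteq> z" "c \<noteq> z" using assms by (auto simp: out_def)
  have "T z a c \<or> T z c a" if "T z a b" "T z b c" using T_left that by blast
  moreover have "T z a c \<or> T z c a" if "T z b a" "T z c b" using T_left that by blast
  moreover have "T z a c \<or> T z c a" if "T z a b" "T z c b" using T_connected_inner that by blast
  moreover have "T z a c \<or> T z c a" if "T z b a" "T z b c"
    using T_connected_outer that ne by metis
  ultimately show ?thesis using assms ne unfolding out_def by blast
qed

lemma out_Col: "out z a b \<Longrightarrow> Col z a b"
  unfolding out_def using T_Cols by blast

lemma out_in_line: "\<lbrakk>is_line L; z \<in> L; out z a b\<rbrakk> \<Longrightarrow> a \<in> L \<longleftrightarrow> b \<in> L"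
  using line_in[of L z a b] line_in[of L z b a] out_Col Col_perm(2) unfolding out_def by blast

lemma T_in_line: "\<lbrakk>is_line L; a \<in> L; b \<in> L; T a x b\<rbrakk> \<Longrightarrow> x \<in> L"
  using line_in[of L a b x] T_Cols by (cases "a = b") auto

lemma opp_reflect: "\<lbrakk>is_line L; m \<in> L; a \<notin> L\<rbrakk> \<Longrightarrow> opp L a (reflect m a)"
  unfolding opp_def using reflect_in_line_iff reflect_T by blast

text \<open>Pasch yields the crossing with \<open>L\<close>: for \<open>b\<close> between
  \<open>z\<close> and \<open>a\<close> it is applied to the ray itself, otherwise to the reflected
  ray.\<close>

lemma opp_reflect_out:
  assumes L: "is_line L" "m \<in> L" "z \<in> L" "a \<notin> L" "out z a b"
  shows "opp L (reflect m a) b"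
proof -
  have b: "b \<notin> L" using out_in_line assms by blast
  have a': "reflect m a \<notin> L" using reflect_in_line_iff L by blast
  from L(5) consider "T z b a" | "T z a b" by (auto simp: out_def)
  then show ?thesis
  proof cases
    case 1
    obtain x where "T m x z" "T b x (reflect m a)"
      using inner_pasch[of "reflect m a" m a z b] reflect_T 1 T_sym by blast
    then show ?thesis unfolding opp_def using T_in_line L b a' T_sym by blast
  next
    case 2
    have "T b m (reflect m b)" "T (reflect m z) (reflect m a) (reflect m b)"
      using reflect_T reflect_T_iff 2 by auto
    then obtain x where "T m x (reflect m z)" "T (reflect m a) x b" by (rule inner_pasch)
    then show ?thesis unfolding opp_def using T_in_line[OF L(1,2)] reflect_in_line L b a' by blast
  qed
qed

text \<open>Excludes a transversal that meets the line \<open>yz\<close> between its crossings with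
  the other two sides. Two uses of Pasch produce a point \<open>w\<close> on \<open>yz\<close> and
  on the segment \<open>ry\<close>; it must be \<open>y\<close>, which puts \<open>n\<close> on
  \<open>yz\<close>.\<close>

lemma triangle_line_aux:
  assumes xyz: "\<not> Col x y z" and "T x n y" "T x r z" "n \<noteq> y" "r \<noteq> z" "T n u r" "Col y z u"
  shows False
proof -
  have yz: "y \<noteq> z" using xyz by auto
  define L where "L = line y z"
  have L: "is_line L" "y \<in> L" "z \<in> L" "u \<in> L" "x \<notin> L"
    using yz assms Col_perm unfolding L_def by auto
  have rL: "r \<notin> L" using line_in[OF L(1,3) _ assms(5)[symmetric]] L T_Cols assms(3) by blast
  have nL: "n \<notin> L" using line_in[OF L(1,2) _ assms(4)[symmetric]] L T_Cols assms(2) by blast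
  have "T y n x" "T z r x" using assms T_sym by blast+
  then obtain v where v: "T n v z" "T r v y" by (rule inner_pasch)
  have "T r u n" "T z v n" using assms v T_sym by blast+
  then obtain w where w: "T u w z" "T v w r" by (rule inner_pasch)
  have wL: "w \<in> L" using T_in_line L w by blast
  have rwy: "T r w y" using w v T_sym T_left by blast
  have "w = y"
  proof (rule ccontr)
    assume "w \<noteq> y"
    then have "r \<in> L" using line_in[OF L(1) wL L(2)] T_Cols[OF rwy] by blast
    then show False using rL by simp
  qed
  then have "v = y" using w v T_eq T_sym by metis
  then have "n \<in> L" using line_in[OF L(1,3,2)] yz T_Cols[OF v(1)] by metis
  then show False using nL by simp
qed

lemma Col_line: assumes "Col a b c" shows "\<exists>K. is_line K \<and> a \<in> K \<and> b \<in> K \<and> c \<in> K"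
proof (cases "a = b")
  case True
  then show ?thesis using line_exists[of a c] by blast
next
  case False
  then show ?thesis using assms by (intro exI[of _ "line a b"]) simp
qed

text \<open>Otherwise \<open>L\<close> would cross all three sides of \<open>a b c\<close>. One of
  the crossings lies between the other two, and \<open>triangle_line_aux\<close> applies with the
  corresponding side as base.\<close>

lemma opp_opp:
  assumes L: "is_line L" and "opp L a b" "opp L b c"
  shows "\<not> opp L a c"
proof
  assume "opp L a c"
  then obtain p q r where p: "p \<in> L" "T a p b" and q: "q \<in> L" "T b q c" and r: "r \<in> L" "T a r c"
    and ne: "a \<notin> L" "b \<notin> L" "c \<notin> L"
    using assms by (auto simp: opp_def)
  show False
  proof (cases "Col a b c")
    case True
    obtain K where K: "is_line K" "a \<in> K" "b \<in> K" "c \<in> K"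
      using Col_line True by blast
    have pqr: "p \<in> K" "q \<in> K" "r \<in> K" using T_in_line K p q r by blast+
    then have "q = p" "r = p" using lines_eq[OF L K(1)] p q r ne K by blast+
    then have "T b p a" "T b p c" "T a p c" "b \<noteq> p" using p q r ne T_sym by auto
    then have "T p a c \<or> T p c a" using T_connected by blast
    then have "p = a \<or> p = c" using \<open>T a p c\<close> T_eq T_sym by metis
    then show False using p ne by auto
  next
    case False
    have pqr: "Col p q r" using line_Col L p q r by blast
    have n: "p \<noteq> a" "p \<noteq> b" "q \<noteq> b" "q \<noteq> c" "r \<noteq> a" "r \<noteq> c" using ne p q r by auto
    from pqr consider "T p q r" | "T q p r" | "T p r q" unfolding Col_def using T_sym by blast
    then show False
    proof cases
      case 1
      show False by (rule triangle_line_aux[OF False p(2) r(2) _ _ 1]) (use n T_Cols[OF q(2)] in auto)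
    next
      case 2
      show False
        by (rule triangle_line_aux[of c b a q r p])
          (use n T_Cols[OF p(2)] 2 q r False T_sym Col_perm in auto)
    next
      case 3
      show False
        by (rule triangle_line_aux[of b a c p q r])
          (use n T_Cols[OF r(2)] 3 q p False T_sym Col_perm in auto)
    qed
  qed
qed

lemma mid_in_line: "\<lbrakk>is_line L; r \<in> L; reflect m r \<in> L\<rbrakk> \<Longrightarrow> m \<in> L"
  using T_in_line reflect_T by blast

lemma reflect_foot:
  assumes L: "is_line L" and a: "foot_of L a r" and m: "reflect m r \<in> L"
  shows "foot_of L (reflect m a) (reflect m r)"
proof -
  have aL: "a \<notin> L" "r \<in> L" "perp L (line r a) r" using a by (auto simp: foot_of_def perp_def)
  have mL: "m \<in> L" using mid_in_line L aL m by blast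
  obtain l where l: "l \<in> L" "l \<noteq> r" using line_other L by blast
  have "Per a r l" using aL l unfolding perp_def using Per_sym in_line Col_triv(3) by blast
  then have "Per (reflect m a) (reflect m r) (reflect m l)"
    using Per_cong reflect_isometry by metis
  then show ?thesis
    using foot_of_I[OF L _ m, of "reflect m a" "reflect m l"] reflect_in_line_iff L mL aL l reflect_inj by metis
qed

lemma foot_line_unique:
  assumes "foot_of L a r" "foot_of L b r"
  shows "Col r a b"
proof -
  have "line r a = line r b" using assms perp_unique_at unfolding foot_of_def by blast
  then show ?thesis using in_line Col_triv(3) by metis
qed

text \<open>In the plane both points lie on the single perpendicular to \<open>L\<close> at
  \<open>s\<close>.\<close>

lemma opp_same_foot:
  assumes L: "is_line L" and a: "foot_of L a s" and c: "foot_of L c s"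
  shows "out s a c \<or> T a s c"
proof -
  have "a \<noteq> s" "c \<noteq> s" using a c by (auto simp: foot_of_def perp_def)
  then show ?thesis using foot_line_unique[OF a c] unfolding out_def Col_def using T_sym by blast
qed

text \<open>\<open>m\<close> is the midpoint of the two feet, so reflecting in it moves
  \<open>a\<close> across \<open>L\<close> onto the perpendicular through \<open>c\<close>. Landing
  on the far side from \<open>c\<close> would put \<open>a\<close>, its image and \<open>c\<close>
  on pairwise opposite sides.\<close>

lemma opp_feet:
  assumes L: "is_line L" and ac: "opp L a c" and a: "foot_of L a r" and c: "foot_of L c (reflect m r)"
  shows "out (reflect m r) (reflect m a) c"
proof -
  have m: "reflect m r \<in> L" "m \<in> L" "a \<notin> L"
    using a c mid_in_line L by (auto simp: foot_of_def perp_def)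
  have "\<not> T (reflect m a) (reflect m r) c"
  proof
    assume "T (reflect m a) (reflect m r) c"
    moreover have "reflect m a \<notin> L" "c \<notin> L" using reflect_foot[OF L a m(1)] c by (auto simp: foot_of_def)
    ultimately have "opp L (reflect m a) c" unfolding opp_def using m by blast
    then show False using opp_opp[OF L opp_reflect[OF L m(2,3)]] ac by blast
  qed
  then show ?thesis using opp_same_foot[OF L reflect_foot[OF L a m(1)] c] by blast
qed

text \<open>Point reflections in midpoints of feet carry \<open>a\<close> and \<open>b\<close> onto
  the perpendicular at the foot \<open>s\<close> of \<open>c\<close>, where being on one side means
  being on one ray from \<open>s\<close>.\<close>

lemma opp_out:
  assumes L: "is_line L" and ac: "opp L a c" and z: "z \<in> L" "out z a b"
  shows "opp L b c"
proof -
  have n: "a \<notin> L" "b \<notin> L" "c \<notin> L" using ac out_in_line L z by (auto simp: opp_def)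
  obtain r where r: "foot_of L a r" using foot_exists[OF L n(1)] by blast
  obtain s where s: "foot_of L c s" using foot_exists[OF L n(3)] by blast
  obtain t where t: "foot_of L b t" using foot_exists[OF L n(2)] by blast
  obtain m where m: "reflect m r = s" by (rule midpoint_exists)
  obtain m' where m': "reflect m' t = s" by (rule midpoint_exists)
  have "r \<in> L" "s \<in> L" "t \<in> L" using r s t by (auto simp: foot_of_def perp_def)
  then have mL: "m \<in> L" "m' \<in> L" using mid_in_line L m m' by metis+
  have 1: "out s (reflect m a) c" using opp_feet[OF L ac r, of m] m s by simp
  have "opp L b (reflect m a)" using opp_reflect_out[OF L mL(1) z(1) n(1) z(2)] opp_sym by blast
  moreover have "foot_of L (reflect m a) s" using reflect_foot[OF L r, of m] m \<open>s \<in> L\<close> by simp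
  ultimately have "out s (reflect m' b) (reflect m a)" using opp_feet[OF L _ t, of _ m'] m' by simp
  then have "out s (reflect m' b) c" using 1 out_trans by blast
  then show ?thesis
    using opp_reflect_out[OF L mL(2) \<open>s \<in> L\<close>, of "reflect m' b" c] reflect_in_line_iff[OF L mL(2)] n by simp
qed

lemma plane_separation:
  assumes L: "is_line L" and ac: "opp L a c" and ab: "\<not> opp L a b" "b \<notin> L"
  shows "opp L b c"
proof (rule ccontr)
  assume bc: "\<not> ?thesis"
  have n: "a \<notin> L" "c \<notin> L" using ac by (auto simp: opp_def)
  obtain r where r: "foot_of L a r" using foot_exists[OF L n(1)] by blast
  obtain s where s: "foot_of L c s" using foot_exists[OF L n(2)] by blast
  obtain t where t: "foot_of L b t" using foot_exists[OF L ab(2)] by blast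
  obtain m where m: "reflect m r = s" by (rule midpoint_exists)
  obtain m' where m': "reflect m' t = s" by (rule midpoint_exists)
  obtain k where k: "reflect k r = t" by (rule midpoint_exists)
  have inL: "r \<in> L" "s \<in> L" "t \<in> L" using r s t by (auto simp: foot_of_def perp_def)
  then have mL: "m \<in> L" "m' \<in> L" "k \<in> L" using mid_in_line L m m' k by metis+
  \<comment> \<open>\<open>u\<close> is \<open>a\<close> moved across \<open>L\<close> onto the
    perpendicular through \<open>b\<close>. As \<open>b\<close> is not opposite \<open>a\<close>, it
    lies on the other ray from \<open>t\<close>.\<close>
  define u where "u = reflect k a"
  have u: "foot_of L u t" unfolding u_def using reflect_foot[OF L r, of k] k inL by simp
  have uL: "u \<notin> L" using u by (simp add: foot_of_def)
  have "\<not> out t u b"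
    using opp_reflect_out[OF L mL(3) inL(3) uL] ab by (auto simp: u_def)
  then have utb: "T u t b" using opp_same_foot[OF L u t] by blast
  define d where "d = reflect m' b"
  have d: "foot_of L d s" unfolding d_def using reflect_foot[OF L t, of m'] m' inL by simp
  have dL: "d \<notin> L" using d by (simp add: foot_of_def)
  have "\<not> out s d c"
    using opp_reflect_out[OF L mL(2) inL(2) dL] bc by (auto simp: d_def)
  then have dsc: "T d s c" using opp_same_foot[OF L d s] by blast
  \<comment> \<open>Both \<open>u'\<close> and \<open>c\<close> lie beyond \<open>s\<close> as seen
    from \<open>d\<close>, so they share a ray. This puts \<open>a\<close>, \<open>u\<close>,
    \<open>u'\<close> on pairwise opposite sides, against \<open>opp_opp\<close>.\<close>
  define u' where "u' = reflect m' u"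
  have "T u' s d" unfolding u'_def d_def using utb reflect_T_iff m' by metis
  then have "T d s u'" using T_sym by blast
  then have "T s c u' \<or> T s u' c" using T_connected dsc dL inL by metis
  moreover have "u' \<noteq> s" unfolding u'_def using uL inL mL reflect_in_line_iff L by metis
  ultimately have "out s c u'" unfolding out_def using n inL by blast
  then have "out s (reflect m a) u'" using opp_feet[OF L ac r, of m] m s out_trans by metis
  then have "opp L a u'"
    using opp_reflect_out[OF L mL(1) inL(2), of "reflect m a" u'] reflect_in_line_iff[OF L mL(1)] n by simp
  moreover have "opp L a u" unfolding u_def using opp_reflect L mL n by blast
  moreover have "opp L u u'" unfolding u'_def using opp_reflect L mL uL by blast
  ultimately show False using opp_opp L by blast
qed

section \<open>Comparison of a hypotenuse with a leg\<close>

lemma ray_point: assumes "a \<noteq> b" "p \<noteq> q" obtains x where "out b a x" "len b x = len p q"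
proof -
  define c where "c = reflect b a"
  have c: "c \<noteq> b" "T c b a" unfolding c_def using assms reflect_eq_iff reflect_T T_sym by blast+
  define x where "x = ext c b p q"
  have x: "T c b x" "len b x = len p q" unfolding x_def using ext_T ext_len c by blast+
  have "x \<noteq> b" using x assms len_null_iff by metis
  then have "out b a x" using T_connected[OF c(1) x(1) c(2)] assms unfolding out_def by blast
  then show ?thesis using that x by blast
qed

lemma Per_Col_eq: "\<lbrakk>Per a b c; Col b a c; a \<noteq> b\<rbrakk> \<Longrightarrow> c = b"
  using Per_Col[of a b c c] Per_self by blast

text \<open>Otherwise, reflecting in the bisector of the angle at \<open>b\<close> turns the perpendicular to
  \<open>ba\<close> inside this angle into a perpendicular to \<open>bm\<close>, which meets \<open>am\<close>.\<close>

lemma altitude_foot: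
  assumes amb: "Per a m b" "a \<noteq> m" "m \<noteq> b" and r: "T a r m" "r \<noteq> a" "r \<noteq> m" and rba: "Per r b a"
  shows False
proof -
  have ncol: "\<not> Col a m b" using Per_Col_eq amb Col_perm by metis
  have ab: "a \<noteq> b" using ncol by auto
  obtain a1 where a1: "out b a a1" "len b a1 = len b m" using ray_point ab amb(3) by metis
  have a1b: "a1 \<noteq> b" using a1 by (simp add: out_def)
  have ncol1: "\<not> Col a1 m b"
  proof
    assume "Col a1 m b"
    then have "Col b a1 m" "Col b a1 a" using Col_perm out_Col[OF a1(1)] by blast+
    then show False using Col_trans[OF a1b[symmetric]] ncol Col_perm by blast
  qed
  \<comment> \<open>On the base line of the isosceles triangle \<open>a1 b m\<close>, reflection in
    the midpoint \<open>j\<close> agrees with the mirror in the bisector at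
    \<open>b\<close>.\<close>
  obtain j where j: "reflect j a1 = m" by (rule midpoint_exists)
  have rb: "r \<noteq> b" using r ncol T_Cols by metis
  define K where "K = line b r"
  have K: "is_line K" "b \<in> K" "r \<in> K" unfolding K_def using rb by auto
  have "a \<notin> K" "m \<notin> K"
    using line_Col[OF K(1)] line_in[OF K(1,3)] K r T_Cols[OF r(1)] ncol by metis+
  then have "opp K a m" unfolding opp_def using K r by blast
  then have "opp K a1 m" using opp_out K a1 by blast
  then obtain r1 where r1: "r1 \<in> K" "T a1 r1 m" and mK: "a1 \<notin> K" "m \<notin> K" by (auto simp: opp_def)
  have r1b: "r1 \<noteq> b" using r1 ncol1 T_Cols by metis
  define r2 where "r2 = reflect j r1"
  have r2: "T m r2 a1" unfolding r2_def using r1 reflect_T_iff j reflect_reflect by metis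
  have "Per r1 b a"
    using Per_Col[OF rba rb] r1 by (simp add: K_def)
  then have "Per a1 b r1" using Per_Col[of a b r1 a1] Per_sym out_Col a1 ab by blast
  moreover have "len r1 b = len r2 b"
  proof (rule inner_five_segment[OF r1(2) r2])
    show "len a1 m = len m a1" "len a1 b = len m b" "len m b = len a1 b"
      using a1 len_commute by metis+
    show "len r1 m = len r2 a1" unfolding r2_def using j reflect_isometry reflect_reflect by metis
  qed
  moreover have "len a1 r1 = len m r2" unfolding r2_def using j reflect_isometry by metis
  ultimately have per2: "Per m b r2" using Per_cong a1 len_commute by metis
  have r2b: "r2 \<noteq> b" using r2 ncol1 T_Cols by metis
  define Q where "Q = line b r2"
  have Q: "is_line Q" "b \<in> Q" "r2 \<in> Q" unfolding Q_def using r2b by auto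
  have mQ: "m \<notin> Q" using Per_Col_eq[OF per2] r2b amb Col_perm unfolding Q_def by auto
  have "r1 \<noteq> m" using r1 mK by auto
  then have "r2 \<noteq> a1" unfolding r2_def using j reflect_reflect by metis
  then have "a1 \<notin> Q" using line_in[OF Q(1) _ Q(3)] T_Cols[OF r2] mQ by metis
  then have "opp Q a1 m" unfolding opp_def using Q mQ r2 T_sym by blast
  then have "opp Q a m" using opp_out Q a1 out_sym by blast
  \<comment> \<open>At \<open>v\<close> the perpendicular to \<open>bm\<close> at \<open>b\<close>
    meets \<open>am\<close>, so the triangle \<open>v b m\<close> has right angles at both
    \<open>b\<close> and \<open>m\<close>.\<close>
  then obtain v where v: "v \<in> Q" "T a v m" by (auto simp: opp_def)
  have "Per v b m" using Per_Col[of r2 b m v] per2 Per_sym r2b v unfolding Q_def by auto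
  moreover have "Per v m b" using Per_Col[of a m b v] amb T_Cols[OF v(2)] by blast
  ultimately show False using Per_Per amb by blast
qed

text \<open>If \<open>d\<close> on the leg \<open>ac\<close> had \<open>ad = ab\<close>, then
  \<open>a\<close> and the midpoint \<open>m\<close> of \<open>db\<close> would span a perpendicular
  to \<open>db\<close>. The perpendicular \<open>L\<close> to \<open>db\<close> at \<open>d\<close>
  is disjoint from it, so \<open>a\<close>, \<open>m\<close>, \<open>b\<close> lie on one side and
  \<open>c\<close> on the other. Hence \<open>L\<close> meets \<open>bc\<close> at some
  \<open>s\<close>, and \<open>altitude_foot\<close> excludes the right angle
  \<open>s d b\<close>.\<close>

lemma hypotenuse_longer:
  assumes acb: "Per a c b" "c \<noteq> b" and d: "T a d c" "d \<noteq> c" "len a d = len a b"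
  shows False
proof -
  have ad: "a \<noteq> d"
  proof
    assume "a = d"
    then have "a = b" using d len_null_iff by metis
    then have "a = c" using acb Per_self by blast
    then show False using d by auto
  qed
  have ac: "a \<noteq> c" using d by auto
  have ncol: "\<not> Col c a b" using Per_Col_eq acb ac by metis
  have db: "d \<noteq> b" using ncol d T_Cols by metis
  obtain m where m: "reflect m d = b" by (rule midpoint_exists)
  have md: "m \<noteq> d" using m db by auto
  have amd: "Per a m d" unfolding Per_def using m d by simp
  have am: "a \<noteq> m"
  proof
    assume "a = m"
    then have "Col a d b" using m reflect_Col Col_perm by metis
    then have "Col a c b" using Col_trans[of a d c b] ad T_Cols[OF d(1)] by blast
    then show False using ncol Col_perm by blast
  qed
  \<comment> \<open>Reflection in \<open>k\<close> exchanges \<open>m\<close> and \<open>d\<close>;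
    it carries the perpendicular through \<open>a\<close> at \<open>m\<close> to one at
    \<open>d\<close>.\<close>
  obtain k where k: "reflect k m = d" by (rule midpoint_exists)
  define g where "g = reflect k a"
  have kd: "reflect k d = m" using k reflect_reflect by metis
  have gdm: "Per g d m" unfolding g_def using Per_cong[OF amd] k kd reflect_isometry by metis
  have gd: "g \<noteq> d" unfolding g_def using k am reflect_inj by metis
  define L where "L = line d g"
  have L: "is_line L" "d \<in> L" "g \<in> L" unfolding L_def using gd by auto
  have disj: "x \<notin> L" if "Col m a x" for x
  proof
    assume "x \<in> L"
    then have "Per x d m" using Per_Col[OF gdm gd] by (simp add: L_def)
    moreover have "Per x m d" using Per_Col[OF amd am that] .
    ultimately show False using Per_Per md by blast
  qed
  have aL: "a \<notin> L" and mL: "m \<notin> L" using disj by auto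
  have cL: "c \<notin> L" using line_in[OF L(1,2), of c a] aL d T_Cols[OF d(1)] by metis
  have "opp L a c" unfolding opp_def using aL cL L d by blast
  moreover have "\<not> opp L a m" using disj T_Cols unfolding opp_def by blast
  ultimately have "opp L m c" using plane_separation[OF L(1)] mL by blast
  moreover have "T d m b" using m reflect_T by metis
  then have "out d m b" unfolding out_def using md db by auto
  ultimately have "opp L b c" using opp_out[OF L(1)] L by blast
  then obtain s where s: "s \<in> L" "T b s c" and bL: "b \<notin> L" by (auto simp: opp_def)
  have "Per d c b" using Per_Col[OF acb(1) ac] T_Cols[OF d(1)] by blast
  then have 1: "Per b c d" using Per_sym by blast
  have "Per s d m" using Per_Col[OF gdm gd] s by (simp add: L_def)
  then have "Per m d s" using Per_sym by blast
  then have "Per s d b" using Per_Col[of m d s b] md T_Cols[OF \<open>T d m b\<close>] Per_sym by blast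
  moreover have "s \<noteq> b" "s \<noteq> c" using s bL cL by auto
  ultimately show False using altitude_foot[OF 1 acb(2)[symmetric] d(2)[symmetric] s(2)] by blast
qed

subsection \<open>The uniform projection\<close>

text \<open>\<open>ext a e e a\<close> is the reflection of \<open>a\<close> in \<open>e\<close>.\<close>

definition guide :: "'a \<Rightarrow> 'a \<Rightarrow> 'a \<Rightarrow> 'a \<Rightarrow> 'a" where
  "guide x a b w =
    (let c = foot a b w; e = ext c w c x in foot (ext a e e a) (ext b e e b) x)"

definition project :: "'a \<Rightarrow> 'a \<Rightarrow> 'a \<Rightarrow> 'a \<Rightarrow> 'a" where
  "project x a b w = foot a b (guide x a b w)"

lemma T_len_eq: "T a b c \<Longrightarrow> len a b = len a c \<Longrightarrow> b = c"
  using T_cong[of a b c a c b] T_eq T_sym len_commute by metis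

lemma project:
  assumes abw: "\<not> Col a b w"
  shows "foot_of (line a b) (guide x a b w) (project x a b w)"
    and "Col (project x a b w) (guide x a b w) x"
proof -
  define L where "L = line a b"
  have ab: "a \<noteq> b" using abw by auto
  have L: "is_line L" "a \<in> L" "b \<in> L" unfolding L_def using ab by auto
  define c where "c = foot a b w"
  have cw: "foot_of L w c" unfolding c_def L_def using foot_of_foot abw by blast
  define K where "K = line c w"
  have perp_K: "perp L K c" and wL: "w \<notin> L" using cw by (auto simp: foot_of_def K_def)
  have K: "is_line K" "c \<in> K" and cL: "c \<in> L" using perp_K by (auto simp: perp_def)
  have cw: "c \<noteq> w" using wL cL by auto
  \<comment> \<open>\<open>ce\<close> has length \<open>cw + cx\<close>. The summand
    \<open>cw\<close> keeps it strictly longer than \<open>cx\<close>, and non-null even for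
    \<open>x = c\<close>.\<close>
  define e where "e = ext c w c x"
  have e: "T c w e" "len w e = len c x" unfolding e_def using cw ext_T ext_len by blast+
  have ec: "e \<noteq> c" using e cw by auto
  have eK: "e \<in> K" unfolding K_def using e T_Cols by simp
  have eL: "e \<notin> L" using perp_meet[OF perp_K _ eK] ec by blast
  define M where "M = line (reflect e a) (reflect e b)"
  have M: "is_line M" unfolding M_def using ab reflect_inj by simp
  have M_iff: "y \<in> M \<longleftrightarrow> reflect e y \<in> L" for y
    unfolding M_def L_def using reflect_Col_iff[of e a b "reflect e y"] by simp
  have disj: "L \<inter> M = {}"
    using M_iff T_in_line[OF L(1)] reflect_T eL by blast
  have xM: "x \<notin> M"
  proof
    assume "x \<in> M"
    \<comment> \<open>\<open>c'\<close> is the foot of \<open>c\<close> on \<open>M\<close>, at a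
      distance greater than \<open>ce\<close>. A point \<open>x\<close> of \<open>M\<close> would
      make \<open>cx\<close> the hypotenuse over the leg \<open>cc'\<close>.\<close>
    define c' where "c' = reflect e c"
    have c': "T c e c'" "c' \<noteq> e" "c' \<in> K"
      unfolding c'_def using reflect_T ec reflect_eq_iff(3) reflect_in_line[OF K(1) eK K(2)] by auto
    have "Per (reflect e x) c c'" using perp_K c' \<open>x \<in> M\<close> M_iff by (auto simp: perp_def)
    then have "Per (reflect e (reflect e x)) (reflect e c) (reflect e c')"
      using Per_cong reflect_isometry by metis
    then have per: "Per c c' x" using Per_sym by (simp add: c'_def)
    \<comment> \<open>In \<open>ce\<close> the part of length \<open>cx\<close> is the far one,
      \<open>we\<close>. Reversing the segment yields \<open>d\<close> with the copy of
      \<open>cx\<close> starting at \<open>c\<close>.\<close>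
    have "T e w c" "len e c = len c e" using e T_sym len_commute by blast+
    then obtain d where d: "T c d e" "len e w = len c d" "len w c = len d e"
      by (rule T_cong_exists)
    have de: "d \<noteq> e" using d cw len_null_iff by metis
    have cd: "len c d = len c x" using d e len_commute by metis
    have cdc': "T c d c'" using d c' T_left by blast
    have dc': "d \<noteq> c'" using d c' de T_middle T_eq T_sym by metis
    have "c' \<noteq> x" using T_len_eq cdc' cd dc' by blast
    then show False using hypotenuse_longer per cdc' dc' cd by blast
  qed
  define g where "g = guide x a b w"
  have "a \<noteq> e" "b \<noteq> e" using L eL by auto
  then have "g = foot (reflect e a) (reflect e b) x"
    by (simp add: g_def guide_def Let_def reflect_def flip: e_def c_def)
  then have "foot_of M x g" using foot_of_foot xM by (simp add: M_def)
  then have g: "perp M (line g x) g" by (simp add: foot_of_def)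
  then have gM: "g \<in> M" by (simp add: perp_def)
  define f where "f = project x a b w"
  have gL: "\<not> Col a b g" using gM disj by (auto simp: L_def)
  have "f = foot a b g" by (simp add: f_def project_def g_def)
  then have f: "foot_of L g f" using foot_of_foot[OF gL] by (simp add: L_def)
  then have "perp L (line f g) f" by (simp add: foot_of_def)
  then have "perp M (line f g) g" using perp_disjoint_line[OF _ M gM _ disj] by auto
  then have "line f g = line g x" using g perp_unique_at by blast
  then have "x \<in> line f g" by simp
  then show "Col (project x a b w) (guide x a b w) x" by (simp add: f_def g_def)
  show "foot_of (line a b) (guide x a b w) (project x a b w)"
    using f by (simp add: f_def g_def L_def)
qed

lemma foot_ofD:
  assumes "foot_of L c x"
  shows "is_line L" "c \<notin> L" "x \<in> L" "c \<noteq> x" "l \<in> L \<Longrightarrow> Per c x l"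
  using assms Per_sym unfolding foot_of_def perp_def by auto

lemma project_perp_exists:
  assumes abw: "\<not> Col a b w"
    and "f = project x a b w" "g = guide x a b w" "l = ext a (ext a b b f) a b"
  shows "Col a b f" "g \<noteq> f" "l \<noteq> f" "Col a b l" "B d f l \<Longrightarrow> len d f = len f l \<Longrightarrow> len g d = len g l"
proof -
  have ab: "a \<noteq> b" using abw by auto
  have f: "foot_of (line a b) g f" using project(1)[OF abw] assms by simp
  show "Col a b f" "g \<noteq> f" using foot_ofD[OF f] by auto
  define m where "m = ext a b b f"
  \<comment> \<open>\<open>m\<close> may coincide with \<open>f\<close>; the further extension by
    \<open>ab\<close> makes \<open>bl\<close> strictly longer than \<open>bf\<close>, so
    \<open>l\<close> differs from \<open>f\<close> wherever \<open>f\<close> lies.\<close>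
  have m: "T a b m" "len b m = len b f" unfolding m_def using ab ext_T ext_len by blast+
  have am: "a \<noteq> m" using m ab by auto
  have l: "T a m l" "len m l = len a b" unfolding assms(4) m_def[symmetric]
    using am ext_T ext_len by blast+
  have lm: "l \<noteq> m" using l ab len_null_iff by metis
  show abl: "Col a b l" using T_left[OF m(1) l(1)] T_Cols by blast
  show "l \<noteq> f" using T_middle[OF m(1) l(1)] T_len_eq m lm by metis
  assume "B d f l" "len d f = len f l"
  then have "d = reflect f l" using reflect_unique T_sym len_commute B_iff by metis
  moreover have "Per g f l" using foot_ofD(5)[OF f] abl by simp
  ultimately show "len g d = len g l" by (simp add: Per_def)
qed

text \<open>\<open>d\<close> is the mirror image of \<open>l\<close> in \<open>f\<close>. The points
  \<open>k\<close>, \<open>f\<close> and \<open>x\<close> are all equidistant from \<open>d\<close>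
  and \<open>l\<close>, hence collinear by \<open>upper_dim\<close>.\<close>

lemma project_perp_contains:
  assumes "\<not> Col a b w" "f = project x a b w" "p \<noteq> q" "Col p q f" "k \<noteq> f" "Col p q k"
    and "l \<noteq> f" "Col a b l" "d = ext l f f l" "B d f l \<Longrightarrow> len d f = len f l \<Longrightarrow> len k d = len k l"
  shows "Col p q x"
proof -
  define g where "g = guide x a b w"
  have f: "foot_of (line a b) g f" using project(1)[OF assms(1)] assms by (simp add: g_def)
  have d: "d = reflect f l" using assms by (simp add: reflect_def)
  have dl: "d \<noteq> l" unfolding d using assms(7) reflect_eq_iff by blast
  have "T d f l" "d \<noteq> f" unfolding d using reflect_T T_sym reflect_eq_iff(3) assms(7) by metis+
  then have "B d f l" using assms(7) B_iff by metis
  moreover have "len d f = len f l" unfolding d using reflect_len len_commute by metis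
  ultimately have kd: "len k d = len k l" using assms(10) by blast
  have fd: "len f d = len f l" unfolding d by (rule reflect_len)
  have "Per g f l" using foot_ofD(5)[OF f] assms by simp
  then have gd: "len g d = len g l" by (simp add: Per_def d)
  have "Col f g x" unfolding g_def assms(2) using project(2)[OF assms(1)] .
  then have "len x d = len x l" using equidistant_Col[of f g x d l] foot_ofD(4)[OF f] fd gd by metis
  then have "Col k f x" using upper_dim[OF dl] kd fd by blast
  then show ?thesis
    using line_in[of "line p q" k f x] assms(3-6) by simp
qed

end

section \<open>Derivations and maximal consistent sets\<close>

lemma subst_tm_comp: "subst_tm \<sigma> (subst_tm \<tau> t) = subst_tm (\<lambda>n. subst_tm \<sigma> (\<tau> n)) t"
  by (induction t) auto

lemma subst_tm_Var[simp]: "subst_tm Var t = t"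
  by (induction t) auto

lemma under_binder_simps[simp]:
  "under_binder \<sigma> 0 = Var 0" "under_binder \<sigma> (Suc n) = lift_tm (\<sigma> n)"
  by (simp_all add: under_binder_def)

lemma subst_tm_lift[simp]: "subst_tm (case_nat t Var) (lift_tm s) = s"
  by (simp add: lift_tm_def subst_tm_comp)

lemma subst_tm_under_lift[simp]: "subst_tm (under_binder \<sigma>) (lift_tm s) = lift_tm (subst_tm \<sigma> s)"
  by (simp add: lift_tm_def subst_tm_comp under_binder_def)

lemma under_binder_comp:
  "(\<lambda>n. subst_tm (under_binder \<sigma>) (under_binder \<tau> n)) = under_binder (\<lambda>n. subst_tm \<sigma> (\<tau> n))"
proof
  fix n show "subst_tm (under_binder \<sigma>) (under_binder \<tau> n) = under_binder (\<lambda>n. subst_tm \<sigma> (\<tau> n)) n"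
    by (cases n) simp_all
qed

lemma subst_fm_comp: "subst_fm \<sigma> (subst_fm \<tau> p) = subst_fm (\<lambda>n. subst_tm \<sigma> (\<tau> n)) p"
  by (induction p arbitrary: \<sigma> \<tau>) (auto simp: subst_tm_comp under_binder_comp)

lemma lift_tm_simps[simp]:
  "lift_tm (Var n) = Var (Suc n)" "lift_tm Alpha = Alpha" "lift_tm Beta = Beta" "lift_tm Gamma = Gamma"
  "lift_tm (Ext q a b c) = Ext (lift_tm q) (lift_tm a) (lift_tm b) (lift_tm c)"
  by (simp_all add: lift_tm_def)

lemma lift_fm_simps[simp]:
  "lift_fm Falsum = Falsum"
  "lift_fm (s \<^bold>= t) = (lift_tm s \<^bold>= lift_tm t)"
  "lift_fm (Between a b c) = Between (lift_tm a) (lift_tm b) (lift_tm c)"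
  "lift_fm (Cong a b c d) = Cong (lift_tm a) (lift_tm b) (lift_tm c) (lift_tm d)"
  "lift_fm (p \<^bold>\<and> q) = (lift_fm p \<^bold>\<and> lift_fm q)"
  "lift_fm (p \<^bold>\<longrightarrow> q) = (lift_fm p \<^bold>\<longrightarrow> lift_fm q)"
  by (simp_all add: lift_fm_def lift_tm_def)

lemma subst_WBetween[simp]:
  "subst_fm \<sigma> (WBetween a b c) = WBetween (subst_tm \<sigma> a) (subst_tm \<sigma> b) (subst_tm \<sigma> c)"
  by (simp add: WBetween_def)

lemma subst_Col[simp]: "subst_fm \<sigma> (Col a b c) = Col (subst_tm \<sigma> a) (subst_tm \<sigma> b) (subst_tm \<sigma> c)"
  by (simp add: Col_def)

lemma lift_Col[simp]: "lift_fm (Col a b c) = Col (lift_tm a) (lift_tm b) (lift_tm c)"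
  by (simp add: lift_fm_def lift_tm_def)

lemma subst_RightAngle[simp]:
  "subst_fm \<sigma> (RightAngle a b c) = RightAngle (subst_tm \<sigma> a) (subst_tm \<sigma> b) (subst_tm \<sigma> c)"
  by (simp add: RightAngle_def Let_def)

lemma subst_PerpAt[simp]:
  "subst_fm \<sigma> (PerpAt p q a b f) =
    PerpAt (subst_tm \<sigma> p) (subst_tm \<sigma> q) (subst_tm \<sigma> a) (subst_tm \<sigma> b) (subst_tm \<sigma> f)"
  by (simp add: PerpAt_def Let_def)

lemma lift_PerpAt[simp]:
  "lift_fm (PerpAt p q a b f) = PerpAt (lift_tm p) (lift_tm q) (lift_tm a) (lift_tm b) (lift_tm f)"
  by (simp add: lift_fm_def lift_tm_def)

lemma weaken: "\<Gamma> \<turnstile> p \<Longrightarrow> \<Gamma> \<subseteq> \<Delta> \<Longrightarrow> \<Delta> \<turnstile> p"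
proof (induction arbitrary: \<Delta> rule: derives.induct)
  case (OrE \<Gamma> p q r)
  then show ?case by (meson derives.OrE insert_mono)
next
  case (ImpI p \<Gamma> q)
  then show ?case by (meson derives.ImpI insert_mono)
next
  case (ForallI \<Gamma> p)
  then show ?case by (meson derives.ForallI image_mono)
next
  case (ExistsE \<Gamma> p q)
  then show ?case by (meson derives.ExistsE insert_mono image_mono)
next
  case (EqSubst \<Gamma> s t p)
  then show ?case by (meson derives.EqSubst)
qed (auto intro: derives.intros)

lemma cut: assumes "\<Gamma> \<turnstile> p" "insert p \<Gamma> \<turnstile> q" shows "\<Gamma> \<turnstile> q"
  using ImpE[OF ImpI[OF assms(2)] assms(1)] .

lemma compactness: "\<Gamma> \<turnstile> p \<Longrightarrow> \<exists>\<Delta>. finite \<Delta> \<and> \<Delta> \<subseteq> \<Gamma> \<and> \<Delta> \<turnstile> p"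
proof (induction rule: derives.induct)
  case (Assm p \<Gamma>)
  then show ?case by (intro exI[of _ "{p}"]) (auto intro: derives.Assm)
next
  case (AndI \<Gamma> p q)
  then obtain \<Delta> \<Theta> where d: "finite \<Delta>" "\<Delta> \<subseteq> \<Gamma>" "\<Delta> \<turnstile> p"
    and t: "finite \<Theta>" "\<Theta> \<subseteq> \<Gamma>" "\<Theta> \<turnstile> q" by blast
  have "\<Delta> \<union> \<Theta> \<turnstile> p \<^bold>\<and> q" by (rule derives.AndI; rule weaken[OF d(3)] weaken[OF t(3)]) auto
  then show ?case using d t by (intro exI[of _ "\<Delta> \<union> \<Theta>"]) auto
next
  case (OrE \<Gamma> p q r)
  then obtain \<Delta> \<Theta> \<Xi> where d: "finite \<Delta>" "\<Delta> \<subseteq> \<Gamma>" "\<Delta> \<turnstile> p \<^bold>\<or> q"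
    and t: "finite \<Theta>" "\<Theta> \<subseteq> insert p \<Gamma>" "\<Theta> \<turnstile> r"
    and x: "finite \<Xi>" "\<Xi> \<subseteq> insert q \<Gamma>" "\<Xi> \<turnstile> r" by blast
  have "\<Delta> \<union> (\<Theta> - {p}) \<union> (\<Xi> - {q}) \<turnstile> r"
    by (rule derives.OrE; rule weaken[OF d(3)] weaken[OF t(3)] weaken[OF x(3)]) auto
  then show ?case using d t x by (intro exI[of _ "\<Delta> \<union> (\<Theta> - {p}) \<union> (\<Xi> - {q})"]) auto
next
  case (ImpI p \<Gamma> q)
  then obtain \<Delta> where d: "finite \<Delta>" "\<Delta> \<subseteq> insert p \<Gamma>" "\<Delta> \<turnstile> q" by blast
  have "\<Delta> - {p} \<turnstile> p \<^bold>\<longrightarrow> q" by (rule derives.ImpI, rule weaken[OF d(3)]) auto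
  then show ?case using d by (intro exI[of _ "\<Delta> - {p}"]) auto
next
  case (ImpE \<Gamma> p q)
  then obtain \<Delta> \<Theta> where d: "finite \<Delta>" "\<Delta> \<subseteq> \<Gamma>" "\<Delta> \<turnstile> p \<^bold>\<longrightarrow> q"
    and t: "finite \<Theta>" "\<Theta> \<subseteq> \<Gamma>" "\<Theta> \<turnstile> p" by blast
  have "\<Delta> \<union> \<Theta> \<turnstile> q" by (rule derives.ImpE; rule weaken[OF d(3)] weaken[OF t(3)]) auto
  then show ?case using d t by (intro exI[of _ "\<Delta> \<union> \<Theta>"]) auto
next
  case (ForallI \<Gamma> p)
  then obtain \<Delta> where "finite \<Delta>" "\<Delta> \<subseteq> lift_fm ` \<Gamma>" "\<Delta> \<turnstile> p" by blast
  then show ?case by (metis finite_subset_image derives.ForallI)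
next
  case (ExistsE \<Gamma> p q)
  then obtain \<Delta> \<Theta> where d: "finite \<Delta>" "\<Delta> \<subseteq> \<Gamma>" "\<Delta> \<turnstile> Exists p"
    and t: "finite \<Theta>" "\<Theta> \<subseteq> insert p (lift_fm ` \<Gamma>)" "\<Theta> \<turnstile> lift_fm q" by blast
  \<comment> \<open>Apart from the witness formula, the finitely many hypotheses used are lifted
    ones and can be pulled back to a finite part of the context.\<close>
  obtain \<Xi> where x: "finite \<Xi>" "\<Xi> \<subseteq> \<Gamma>" "\<Theta> - {p} = lift_fm ` \<Xi>"
    using finite_subset_image[of "\<Theta> - {p}" lift_fm \<Gamma>] t by auto
  have "insert p (lift_fm ` (\<Delta> \<union> \<Xi>)) \<turnstile> lift_fm q" by (rule weaken[OF t(3)]) (use x in auto)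
  moreover have "\<Delta> \<union> \<Xi> \<turnstile> Exists p" by (rule weaken[OF d(3)]) auto
  ultimately have "\<Delta> \<union> \<Xi> \<turnstile> q" using derives.ExistsE by blast
  then show ?case using d x by (intro exI[of _ "\<Delta> \<union> \<Xi>"]) auto
next
  case (EqSubst \<Gamma> s t p)
  then obtain \<Delta> \<Theta> where d: "finite \<Delta>" "\<Delta> \<subseteq> \<Gamma>" "\<Delta> \<turnstile> s \<^bold>= t"
    and t: "finite \<Theta>" "\<Theta> \<subseteq> \<Gamma>" "\<Theta> \<turnstile> inst p s" by blast
  have "\<Delta> \<union> \<Theta> \<turnstile> inst p t"
    by (rule derives.EqSubst; rule weaken[OF d(3)] weaken[OF t(3)]) auto
  then show ?case using d t by (intro exI[of _ "\<Delta> \<union> \<Theta>"]) auto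
next
  case (EqRefl \<Gamma> t)
  then show ?case by (intro exI[of _ "{}"]) (auto intro: derives.EqRefl)
qed (blast intro: derives.intros)+

text \<open>Consistency is that of the intuitionistic calculus. Maximality still makes implication
  and conjunction two-valued on membership, as in classical truth tables.\<close>

definition maxcons :: "fm set \<Rightarrow> bool" where
  "maxcons \<Delta> \<longleftrightarrow> \<not> \<Delta> \<turnstile> Falsum \<and> (\<forall>p. p \<notin> \<Delta> \<longrightarrow> insert p \<Delta> \<turnstile> Falsum)"

lemma Lindenbaum:
  assumes "\<not> \<Gamma> \<turnstile> Falsum"
  obtains \<Delta> where "\<Gamma> \<subseteq> \<Delta>" "maxcons \<Delta>"
proof -
  define C where "C = {\<Delta>. \<Gamma> \<subseteq> \<Delta> \<and> \<not> \<Delta> \<turnstile> Falsum}"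
  have "\<exists>U\<in>C. \<forall>X\<in>\<C>. X \<subseteq> U" if ch: "subset.chain C \<C>" for \<C>
  proof (cases "\<C> = {}")
    case True
    then show ?thesis using assms by (auto simp: C_def)
  next
    case False
    have CC: "\<C> \<subseteq> C" using ch by (auto simp: subset.chain_def)
    have "\<not> \<Union>\<C> \<turnstile> Falsum"
    proof
      assume "\<Union>\<C> \<turnstile> Falsum"
      then obtain \<Theta> where t: "finite \<Theta>" "\<Theta> \<subseteq> \<Union>\<C>" "\<Theta> \<turnstile> Falsum" using compactness by blast
      obtain X where "X \<in> \<C>" "\<Theta> \<subseteq> X"
        using finite_subset_Union_chain[OF t(1,2) False ch] by blast
      then show False using t(3) weaken CC by (auto simp: C_def)
    qed
    then have "\<Union>\<C> \<in> C" using False CC by (auto simp: C_def)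
    then show ?thesis by blast
  qed
  then obtain \<Delta> where d: "\<Delta> \<in> C" "\<forall>X\<in>C. \<Delta> \<subseteq> X \<longrightarrow> X = \<Delta>"
    using subset_Zorn[of C] by blast
  have "maxcons \<Delta>"
    unfolding maxcons_def
  proof (intro conjI allI impI)
    show "\<not> \<Delta> \<turnstile> Falsum" using d by (simp add: C_def)
    fix p assume "p \<notin> \<Delta>"
    then have "insert p \<Delta> \<notin> C" using d(2) by blast
    then show "insert p \<Delta> \<turnstile> Falsum" using d(1) by (auto simp: C_def)
  qed
  then show ?thesis using that[of \<Delta>] d(1) by (simp add: C_def)
qed

lemma maxcons_derives: assumes "maxcons \<Delta>" shows "\<Delta> \<turnstile> p \<longleftrightarrow> p \<in> \<Delta>"
  using assms cut[of \<Delta> p Falsum] Assm[of p \<Delta>] unfolding maxcons_def by blast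

lemma maxcons_simps:
  assumes m: "maxcons \<Delta>"
  shows "Falsum \<notin> \<Delta>" "p \<^bold>\<and> q \<in> \<Delta> \<longleftrightarrow> p \<in> \<Delta> \<and> q \<in> \<Delta>" "p \<^bold>\<longrightarrow> q \<in> \<Delta> \<longleftrightarrow> (p \<in> \<Delta> \<longrightarrow> q \<in> \<Delta>)"
proof -
  show "Falsum \<notin> \<Delta>" using m Assm[of Falsum \<Delta>] unfolding maxcons_def by blast
  show "p \<^bold>\<and> q \<in> \<Delta> \<longleftrightarrow> p \<in> \<Delta> \<and> q \<in> \<Delta>"
    using maxcons_derives[OF m] AndI[of \<Delta> p q] AndE1[of \<Delta> p q] AndE2[of \<Delta> p q] by blast
  have "p \<^bold>\<longrightarrow> q \<in> \<Delta>" if "p \<notin> \<Delta> \<or> q \<in> \<Delta>"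
  proof -
    have "insert p \<Delta> \<turnstile> q"
      using that m FalsumE[of "insert p \<Delta>" q] Assm[of q "insert p \<Delta>"]
      unfolding maxcons_def by blast
    then show ?thesis using maxcons_derives[OF m] ImpI[of p \<Delta> q] by blast
  qed
  then show "p \<^bold>\<longrightarrow> q \<in> \<Delta> \<longleftrightarrow> (p \<in> \<Delta> \<longrightarrow> q \<in> \<Delta>)"
    using maxcons_derives[OF m] ImpE[of \<Delta> p q] by blast
qed

text \<open>A Glivenko-style argument: were \<open>\<not> p\<close> consistent with the context,
  some maximal consistent extension would contain both \<open>p\<close> and its negation.\<close>

lemma Neg_Neg_complete:
  assumes "\<And>\<Delta>. \<Gamma> \<subseteq> \<Delta> \<Longrightarrow> maxcons \<Delta> \<Longrightarrow> p \<in> \<Delta>"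
  shows "\<Gamma> \<turnstile> \<^bold>\<not> \<^bold>\<not> p"
proof (rule ImpI, rule ccontr)
  assume "\<not> insert (\<^bold>\<not> p) \<Gamma> \<turnstile> Falsum"
  then obtain \<Delta> where d: "insert (\<^bold>\<not> p) \<Gamma> \<subseteq> \<Delta>" "maxcons \<Delta>" by (rule Lindenbaum)
  then have "p \<in> \<Delta>" "\<^bold>\<not> p \<in> \<Delta>" using assms by auto
  then show False using maxcons_simps[OF d(2)] by simp
qed

text \<open>Applies to \<open>Col\<close> and to inequalities, which are negations by
  definition.\<close>

lemma Neg_stable: "\<Gamma> \<turnstile> \<^bold>\<not> \<^bold>\<not> \<^bold>\<not> p \<Longrightarrow> \<Gamma> \<turnstile> \<^bold>\<not> p"
proof (rule ImpI)
  assume *: "\<Gamma> \<turnstile> \<^bold>\<not> \<^bold>\<not> \<^bold>\<not> p"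
  have "insert p \<Gamma> \<turnstile> \<^bold>\<not> \<^bold>\<not> p"
    by (rule ImpI, rule ImpE[of _ p]) (auto intro: Assm)
  then show "insert p \<Gamma> \<turnstile> Falsum" using weaken[OF *] ImpE by blast
qed

lemma Foralls_Suc: "Foralls (Suc n) p = Foralls n (Forall p)"
  by (simp add: Foralls_def funpow_swap1)

text \<open>Index 0 belongs to the innermost quantifier, so the head of \<open>ts\<close> is
  instantiated last.\<close>

lemma ForallsE:
  assumes "\<Gamma> \<turnstile> Foralls (length ts) p"
  shows "\<Gamma> \<turnstile> subst_fm (\<lambda>i. if i < length ts then ts ! i else Var (i - length ts)) p"
  using assms
proof (induction ts arbitrary: p)
  case Nil
  have "subst_fm Var p = p"
  proof (induction p)
    case (Forall p)
    have "under_binder Var = Var" by (auto simp: under_binder_def fun_eq_iff split: nat.split)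
    then show ?case using Forall by simp
  next
    case (Exists p)
    have "under_binder Var = Var" by (auto simp: under_binder_def fun_eq_iff split: nat.split)
    then show ?case using Exists by simp
  qed auto
  then show ?case using Nil by (simp add: Foralls_def)
next
  case (Cons t ts)
  define \<sigma> where "\<sigma> = (\<lambda>i. if i < length ts then ts ! i else Var (i - length ts))"
  have "\<Gamma> \<turnstile> subst_fm \<sigma> (Forall p)"
    using Cons.IH[of "Forall p"] Cons.prems unfolding \<sigma>_def length_Cons Foralls_Suc by blast
  then have "\<Gamma> \<turnstile> inst (subst_fm (under_binder \<sigma>) p) t" using ForallE by simp
  moreover have "(\<lambda>n. subst_tm (case_nat t Var) (under_binder \<sigma> n)) =
      (\<lambda>i. if i < length (t # ts) then (t # ts) ! i else Var (i - length (t # ts)))"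
    by (auto simp: fun_eq_iff under_binder_def \<sigma>_def split: nat.split)
  ultimately show ?case by (simp add: inst_def subst_fm_comp)
qed

lemma ForallsI: "lift_fm ` \<Gamma> = \<Gamma> \<Longrightarrow> \<Gamma> \<turnstile> p \<Longrightarrow> \<Gamma> \<turnstile> Foralls n p"
  by (induction n) (auto simp: Foralls_def intro: ForallI)

lemma subst_Foralls: "subst_fm \<sigma> (Foralls n p) = Foralls n (subst_fm ((under_binder ^^ n) \<sigma>) p)"
  by (induction n arbitrary: \<sigma>) (simp_all add: Foralls_def funpow_swap1[of under_binder])

text \<open>The axioms are closed formulas, so they survive the lifting of the context in
  \<open>ForallI\<close> and \<open>ExistsE\<close>.\<close>

lemma lift_tarski: "lift_fm ` intuitionistic_tarski = intuitionistic_tarski"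
  by (simp add: intuitionistic_tarski_def lift_fm_def subst_Foralls eval_nat_numeral Let_def
      A1_def A2_def A3_def A4i_def A5_def A6i_def A7i_def A8_def A9_def A10\<^sub>3_def A14i_def A15i_def
      stable_def)

section \<open>Derivability of the projection property\<close>

definition isosceles_mid_tm :: "tm \<Rightarrow> tm \<Rightarrow> tm \<Rightarrow> tm" where
  "isosceles_mid_tm c a b =
    Ip c a (Ext c a Alpha Beta) b (Ip (Ext c a Alpha Beta) a c (Ext c b Alpha Beta) b)"

definition foot_tm :: "tm \<Rightarrow> tm \<Rightarrow> tm \<Rightarrow> tm" where
  "foot_tm a b c =
    (let y = Ext b a a c; p = isosceles_mid_tm a c y; z = Ext a y y p; q = Ext p y y a;
         q' = Ext q z z q; c' = Ext q' y y c
     in isosceles_mid_tm y c c')"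

definition guide_tm :: "tm \<Rightarrow> tm \<Rightarrow> tm \<Rightarrow> tm \<Rightarrow> tm" where
  "guide_tm x a b w =
    (let c = foot_tm a b w; e = Ext c w c x in foot_tm (Ext a e e a) (Ext b e e b) x)"

definition project_tm :: "tm \<Rightarrow> tm \<Rightarrow> tm \<Rightarrow> tm \<Rightarrow> tm" where
  "project_tm x a b w = foot_tm a b (guide_tm x a b w)"

lemma tvars_isosceles_mid_tm: "tvars (isosceles_mid_tm c a b) = tvars a \<union> tvars b \<union> tvars c"
  by (auto simp: isosceles_mid_tm_def)

lemma tvars_foot_tm: "tvars (foot_tm a b c) = tvars a \<union> tvars b \<union> tvars c"
  by (auto simp: foot_tm_def Let_def tvars_isosceles_mid_tm)

lemma tvars_project_tm: "tvars (project_tm x a b w) = tvars x \<union> tvars a \<union> tvars b \<union> tvars w"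
  by (auto simp: project_tm_def guide_tm_def Let_def tvars_foot_tm)

lemma subst_isosceles_mid_tm: "subst_tm \<sigma> (isosceles_mid_tm c a b) =
    isosceles_mid_tm (subst_tm \<sigma> c) (subst_tm \<sigma> a) (subst_tm \<sigma> b)"
  by (simp add: isosceles_mid_tm_def)

lemma subst_foot_tm:
  "subst_tm \<sigma> (foot_tm a b c) = foot_tm (subst_tm \<sigma> a) (subst_tm \<sigma> b) (subst_tm \<sigma> c)"
  by (simp add: foot_tm_def Let_def subst_isosceles_mid_tm)

lemma subst_guide_tm: "subst_tm \<sigma> (guide_tm x a b w) =
    guide_tm (subst_tm \<sigma> x) (subst_tm \<sigma> a) (subst_tm \<sigma> b) (subst_tm \<sigma> w)"
  by (simp add: guide_tm_def Let_def subst_foot_tm)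

lemma subst_project_tm: "subst_tm \<sigma> (project_tm x a b w) =
    project_tm (subst_tm \<sigma> x) (subst_tm \<sigma> a) (subst_tm \<sigma> b) (subst_tm \<sigma> w)"
  by (simp add: project_tm_def subst_foot_tm subst_guide_tm)

lemmas lift_guide_tm = subst_guide_tm[of "\<lambda>n. Var (Suc n)", folded lift_tm_def]
lemmas lift_project_tm = subst_project_tm[of "\<lambda>n. Var (Suc n)", folded lift_tm_def]

text \<open>Witness for the second existential quantifier in \<open>PerpAt\<close>: a point of the
  line \<open>ab\<close> other than the foot, found without deciding whether the foot is
  \<open>a\<close> or \<open>b\<close>.\<close>

definition off_foot_tm :: "tm \<Rightarrow> tm \<Rightarrow> tm \<Rightarrow> tm" where
  "off_foot_tm a b f = Ext a (Ext a b b f) a b"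

lemma lift_off_foot_tm: "lift_tm (off_foot_tm a b f) = off_foot_tm (lift_tm a) (lift_tm b) (lift_tm f)"
  by (simp add: off_foot_tm_def)

text \<open>The quantifier-free core of the theorem: object quantifiers have become metalevel
  quantifiers over terms, and the right angle at \<open>f\<close> is assumed only for the mirror
  image \<open>Ext l f f l\<close> of \<open>l\<close>.\<close>

definition projects :: "fm set \<Rightarrow> bool" where
  "projects \<Delta> \<longleftrightarrow> (\<forall>x a b w. a \<^bold>\<noteq> b \<in> \<Delta> \<longrightarrow> \<^bold>\<not> Col a b w \<in> \<Delta> \<longrightarrow>
    (let f = project_tm x a b w; g = guide_tm x a b w; l = off_foot_tm a b f in
      Col a b f \<in> \<Delta> \<and> g \<^bold>\<noteq> f \<in> \<Delta> \<and> l \<^bold>\<noteq> f \<in> \<Delta> \<and> Col a b l \<in> \<Delta> \<and>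
      (\<forall>d. Between d f l \<^bold>\<and> Cong d f f l \<in> \<Delta> \<longrightarrow> Cong g d g l \<in> \<Delta>) \<and>
      (\<forall>p q k l. p \<^bold>\<noteq> q \<in> \<Delta> \<longrightarrow> Col p q f \<in> \<Delta> \<longrightarrow> k \<^bold>\<noteq> f \<in> \<Delta> \<longrightarrow> Col p q k \<in> \<Delta> \<longrightarrow>
        l \<^bold>\<noteq> f \<in> \<Delta> \<longrightarrow> Col a b l \<in> \<Delta> \<longrightarrow>
        (let d = Ext l f f l in Between d f l \<^bold>\<and> Cong d f f l \<^bold>\<longrightarrow> Cong k d k l) \<in> \<Delta> \<longrightarrow>
        Col p q x \<in> \<Delta>)))"

text \<open>Since a quotient type cannot depend on a variable theory, the term model is built once, over
  a counterexample if there is one.\<close>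

definition test_theory :: "fm set" where
  "test_theory = (SOME \<Delta>. maxcons \<Delta> \<and> intuitionistic_tarski \<subseteq> \<Delta> \<and> \<not> projects \<Delta>)"

section \<open>The term model over \<open>test_theory\<close>\<close>

lemma eq_replace: "\<Gamma> \<turnstile> inst p s \<Longrightarrow> \<Gamma> \<turnstile> s \<^bold>= t \<Longrightarrow> inst p t = q \<Longrightarrow> \<Gamma> \<turnstile> q"
  using EqSubst by blast

lemma Eq_sym: "\<Gamma> \<turnstile> s \<^bold>= t \<Longrightarrow> \<Gamma> \<turnstile> t \<^bold>= s"
  by (rule eq_replace[where p = "Var 0 \<^bold>= lift_tm s"]) (simp_all add: inst_def EqRefl)

lemma Eq_trans: "\<Gamma> \<turnstile> s \<^bold>= t \<Longrightarrow> \<Gamma> \<turnstile> t \<^bold>= u \<Longrightarrow> \<Gamma> \<turnstile> s \<^bold>= u"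
  by (rule eq_replace[where p = "lift_tm s \<^bold>= Var 0"]) (simp_all add: inst_def)

quotient_type point = tm / "\<lambda>s t. test_theory \<turnstile> s \<^bold>= t"
  by (intro equivpI reflpI sympI transpI) (auto intro: EqRefl Eq_sym Eq_trans)

lemma Between_cong:
  assumes "\<Gamma> \<turnstile> a \<^bold>= a'" "\<Gamma> \<turnstile> b \<^bold>= b'" "\<Gamma> \<turnstile> c \<^bold>= c'" "\<Gamma> \<turnstile> Between a b c"
  shows "\<Gamma> \<turnstile> Between a' b' c'"
proof -
  have 1: "\<Gamma> \<turnstile> Between a' b c"
    by (rule eq_replace[OF _ assms(1), where p = "Between (Var 0) (lift_tm b) (lift_tm c)"])
      (simp_all add: inst_def assms(4))
  have 2: "\<Gamma> \<turnstile> Between a' b' c"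
    by (rule eq_replace[OF _ assms(2), where p = "Between (lift_tm a') (Var 0) (lift_tm c)"])
      (simp_all add: inst_def 1)
  show ?thesis
    by (rule eq_replace[OF _ assms(3), where p = "Between (lift_tm a') (lift_tm b') (Var 0)"])
      (simp_all add: inst_def 2)
qed

lemma Cong_cong:
  assumes "\<Gamma> \<turnstile> a \<^bold>= a'" "\<Gamma> \<turnstile> b \<^bold>= b'" "\<Gamma> \<turnstile> c \<^bold>= c'" "\<Gamma> \<turnstile> d \<^bold>= d'" "\<Gamma> \<turnstile> Cong a b c d"
  shows "\<Gamma> \<turnstile> Cong a' b' c' d'"
proof -
  have 1: "\<Gamma> \<turnstile> Cong a' b c d"
    by (rule eq_replace[OF _ assms(1), where p = "Cong (Var 0) (lift_tm b) (lift_tm c) (lift_tm d)"])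
      (simp_all add: inst_def assms(5))
  have 2: "\<Gamma> \<turnstile> Cong a' b' c d"
    by (rule eq_replace[OF _ assms(2), where p = "Cong (lift_tm a') (Var 0) (lift_tm c) (lift_tm d)"])
      (simp_all add: inst_def 1)
  have 3: "\<Gamma> \<turnstile> Cong a' b' c' d"
    by (rule eq_replace[OF _ assms(3), where p = "Cong (lift_tm a') (lift_tm b') (Var 0) (lift_tm d)"])
      (simp_all add: inst_def 2)
  show ?thesis
    by (rule eq_replace[OF _ assms(4), where p = "Cong (lift_tm a') (lift_tm b') (lift_tm c') (Var 0)"])
      (simp_all add: inst_def 3)
qed

lemma Ext_cong:
  assumes "\<Gamma> \<turnstile> a \<^bold>= a'" "\<Gamma> \<turnstile> b \<^bold>= b'" "\<Gamma> \<turnstile> c \<^bold>= c'" "\<Gamma> \<turnstile> d \<^bold>= d'"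
  shows "\<Gamma> \<turnstile> Ext a b c d \<^bold>= Ext a' b' c' d'"
proof -
  have 1: "\<Gamma> \<turnstile> Ext a b c d \<^bold>= Ext a' b c d"
    by (rule eq_replace[OF _ assms(1), where p = "lift_tm (Ext a b c d) \<^bold>= Ext (Var 0) (lift_tm b) (lift_tm c) (lift_tm d)"])
      (simp_all add: inst_def EqRefl)
  have 2: "\<Gamma> \<turnstile> Ext a b c d \<^bold>= Ext a' b' c d"
    by (rule eq_replace[OF _ assms(2), where p = "lift_tm (Ext a b c d) \<^bold>= Ext (lift_tm a') (Var 0) (lift_tm c) (lift_tm d)"])
      (simp_all add: inst_def 1)
  have 3: "\<Gamma> \<turnstile> Ext a b c d \<^bold>= Ext a' b' c' d"
    by (rule eq_replace[OF _ assms(3), where p = "lift_tm (Ext a b c d) \<^bold>= Ext (lift_tm a') (lift_tm b') (Var 0) (lift_tm d)"])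
      (simp_all add: inst_def 2)
  show ?thesis
    by (rule eq_replace[OF _ assms(4), where p = "lift_tm (Ext a b c d) \<^bold>= Ext (lift_tm a') (lift_tm b') (lift_tm c') (Var 0)"])
      (simp_all add: inst_def 3)
qed

lemma Ip_cong:
  assumes "\<Gamma> \<turnstile> a \<^bold>= a'" "\<Gamma> \<turnstile> b \<^bold>= b'" "\<Gamma> \<turnstile> c \<^bold>= c'" "\<Gamma> \<turnstile> d \<^bold>= d'" "\<Gamma> \<turnstile> e \<^bold>= e'"
  shows "\<Gamma> \<turnstile> Ip a b c d e \<^bold>= Ip a' b' c' d' e'"
proof -
  have 1: "\<Gamma> \<turnstile> Ip a b c d e \<^bold>= Ip a' b c d e"
    by (rule eq_replace[OF _ assms(1), where p = "lift_tm (Ip a b c d e) \<^bold>= Ip (Var 0) (lift_tm b) (lift_tm c) (lift_tm d) (lift_tm e)"])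
      (simp_all add: inst_def EqRefl)
  have 2: "\<Gamma> \<turnstile> Ip a b c d e \<^bold>= Ip a' b' c d e"
    by (rule eq_replace[OF _ assms(2), where p = "lift_tm (Ip a b c d e) \<^bold>= Ip (lift_tm a') (Var 0) (lift_tm c) (lift_tm d) (lift_tm e)"])
      (simp_all add: inst_def 1)
  have 3: "\<Gamma> \<turnstile> Ip a b c d e \<^bold>= Ip a' b' c' d e"
    by (rule eq_replace[OF _ assms(3), where p = "lift_tm (Ip a b c d e) \<^bold>= Ip (lift_tm a') (lift_tm b') (Var 0) (lift_tm d) (lift_tm e)"])
      (simp_all add: inst_def 2)
  have 4: "\<Gamma> \<turnstile> Ip a b c d e \<^bold>= Ip a' b' c' d' e"
    by (rule eq_replace[OF _ assms(4), where p = "lift_tm (Ip a b c d e) \<^bold>= Ip (lift_tm a') (lift_tm b') (lift_tm c') (Var 0) (lift_tm e)"])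
      (simp_all add: inst_def 3)
  show ?thesis
    by (rule eq_replace[OF _ assms(5), where p = "lift_tm (Ip a b c d e) \<^bold>= Ip (lift_tm a') (lift_tm b') (lift_tm c') (lift_tm d') (Var 0)"])
      (simp_all add: inst_def 4)
qed

lemma Center_cong:
  assumes "\<Gamma> \<turnstile> a \<^bold>= a'" "\<Gamma> \<turnstile> b \<^bold>= b'" "\<Gamma> \<turnstile> c \<^bold>= c'"
  shows "\<Gamma> \<turnstile> Center a b c \<^bold>= Center a' b' c'"
proof -
  have 1: "\<Gamma> \<turnstile> Center a b c \<^bold>= Center a' b c"
    by (rule eq_replace[OF _ assms(1), where p = "lift_tm (Center a b c) \<^bold>= Center (Var 0) (lift_tm b) (lift_tm c)"])
      (simp_all add: inst_def EqRefl)
  have 2: "\<Gamma> \<turnstile> Center a b c \<^bold>= Center a' b' c"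
    by (rule eq_replace[OF _ assms(2), where p = "lift_tm (Center a b c) \<^bold>= Center (lift_tm a') (Var 0) (lift_tm c)"])
      (simp_all add: inst_def 1)
  show ?thesis
    by (rule eq_replace[OF _ assms(3), where p = "lift_tm (Center a b c) \<^bold>= Center (lift_tm a') (lift_tm b') (Var 0)"])
      (simp_all add: inst_def 2)
qed

lift_definition point_B :: "point \<Rightarrow> point \<Rightarrow> point \<Rightarrow> bool" is
  "\<lambda>a b c. test_theory \<turnstile> Between a b c"
  by (rule iffI; rule Between_cong; (assumption | rule Eq_sym, assumption))

lift_definition point_E :: "point \<Rightarrow> point \<Rightarrow> point \<Rightarrow> point \<Rightarrow> bool" is
  "\<lambda>a b c d. test_theory \<turnstile> Cong a b c d"
  by (rule iffI; rule Cong_cong; (assumption | rule Eq_sym, assumption))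

lift_definition point_ext :: "point \<Rightarrow> point \<Rightarrow> point \<Rightarrow> point \<Rightarrow> point" is Ext
  by (rule Ext_cong)

lift_definition point_ip :: "point \<Rightarrow> point \<Rightarrow> point \<Rightarrow> point \<Rightarrow> point \<Rightarrow> point" is Ip
  by (rule Ip_cong)

lift_definition point_center :: "point \<Rightarrow> point \<Rightarrow> point \<Rightarrow> point" is Center
  by (rule Center_cong)

text \<open>Congruence is an equivalence on pairs by A1 and A2, so its classes can serve as the
  lengths that \<open>tarski_plane\<close> expects.\<close>

definition point_len :: "point \<Rightarrow> point \<Rightarrow> (point \<times> point) set" where
  "point_len a b = {(c, d). point_E a b c d}"

lemma axiom_instance:
  assumes "intuitionistic_tarski \<subseteq> \<Gamma>" "Foralls n p \<in> intuitionistic_tarski" "length ts = n"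
  shows "\<Gamma> \<turnstile> subst_fm (\<lambda>i. if i < n then ts ! i else Var (i - n)) p"
  using ForallsE[of \<Gamma> ts p] Assm[of "Foralls n p" \<Gamma>] assms by auto

context
  fixes \<Gamma> assumes T: "intuitionistic_tarski \<subseteq> \<Gamma>"
begin

lemma axioms:
  "\<Gamma> \<turnstile> A1 a b" "\<Gamma> \<turnstile> A2 a b c d e f" "\<Gamma> \<turnstile> A3 a b c" "\<Gamma> \<turnstile> A4i a b c d"
  "\<Gamma> \<turnstile> A5 a b c d a' b' c' d'" "\<Gamma> \<turnstile> A6i a b" "\<Gamma> \<turnstile> A7i a b c d e" "\<Gamma> \<turnstile> A8"
  "\<Gamma> \<turnstile> A9 a b c d e" "\<Gamma> \<turnstile> A10\<^sub>3 a b c" "\<Gamma> \<turnstile> A14i a b c" "\<Gamma> \<turnstile> A15i a b c d"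
  "\<Gamma> \<turnstile> stable (Cong a b c d)"
  subgoal using axiom_instance[OF T, of 2 "A1 (Var 0) (Var 1)" "[a,b]"]
    by (simp add: intuitionistic_tarski_def A1_def)
  subgoal using axiom_instance[OF T, of 6 "A2 (Var 0) (Var 1) (Var 2) (Var 3) (Var 4) (Var 5)" "[a,b,c,d,e,f]"]
    by (simp add: intuitionistic_tarski_def A2_def)
  subgoal using axiom_instance[OF T, of 3 "A3 (Var 0) (Var 1) (Var 2)" "[a,b,c]"]
    by (simp add: intuitionistic_tarski_def A3_def)
  subgoal using axiom_instance[OF T, of 4 "A4i (Var 0) (Var 1) (Var 2) (Var 3)" "[a,b,c,d]"]
    by (simp add: intuitionistic_tarski_def A4i_def Let_def)
  subgoal using axiom_instance[OF T, of 8
      "A5 (Var 0) (Var 1) (Var 2) (Var 3) (Var 4) (Var 5) (Var 6) (Var 7)" "[a,b,c,d,a',b',c',d']"]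
    by (simp add: intuitionistic_tarski_def A5_def)
  subgoal using axiom_instance[OF T, of 2 "A6i (Var 0) (Var 1)" "[a,b]"]
    by (simp add: intuitionistic_tarski_def A6i_def)
  subgoal using axiom_instance[OF T, of 5 "A7i (Var 0) (Var 1) (Var 2) (Var 3) (Var 4)" "[a,b,c,d,e]"]
    by (simp add: intuitionistic_tarski_def A7i_def Let_def)
  subgoal using T by (auto intro!: Assm simp: intuitionistic_tarski_def)
  subgoal using axiom_instance[OF T, of 5 "A9 (Var 0) (Var 1) (Var 2) (Var 3) (Var 4)" "[a,b,c,d,e]"]
    by (simp add: intuitionistic_tarski_def A9_def)
  subgoal using axiom_instance[OF T, of 3 "A10\<^sub>3 (Var 0) (Var 1) (Var 2)" "[a,b,c]"]
    by (simp add: intuitionistic_tarski_def A10\<^sub>3_def Let_def)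
  subgoal using axiom_instance[OF T, of 3 "A14i (Var 0) (Var 1) (Var 2)" "[a,b,c]"]
    by (simp add: intuitionistic_tarski_def A14i_def)
  subgoal using axiom_instance[OF T, of 4 "A15i (Var 0) (Var 1) (Var 2) (Var 3)" "[a,b,c,d]"]
    by (simp add: intuitionistic_tarski_def A15i_def)
  subgoal using axiom_instance[OF T, of 4 "stable (Cong (Var 0) (Var 1) (Var 2) (Var 3))" "[a,b,c,d]"]
    by (simp add: intuitionistic_tarski_def stable_def)
  done

end

context
  assumes m: "maxcons test_theory" and T: "intuitionistic_tarski \<subseteq> test_theory"
begin

lemmas mem = maxcons_derives[OF m]

lemma connectives:
  "test_theory \<turnstile> p \<^bold>\<longrightarrow> q \<longleftrightarrow> (test_theory \<turnstile> p \<longrightarrow> test_theory \<turnstile> q)"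
  "test_theory \<turnstile> p \<^bold>\<and> q \<longleftrightarrow> test_theory \<turnstile> p \<and> test_theory \<turnstile> q"
  "\<not> test_theory \<turnstile> Falsum"
  using maxcons_simps[OF m] by (simp_all add: mem)

lemma point_T: "betweenness.T point_B (abs_point a) (abs_point b) (abs_point c) \<longleftrightarrow>
    test_theory \<turnstile> WBetween a b c"
  by (auto simp: betweenness.T_def WBetween_def connectives point_B.abs_eq point.abs_eq_iff)

lemma point_Col: "betweenness.Col point_B (abs_point a) (abs_point b) (abs_point c) \<longleftrightarrow>
    test_theory \<turnstile> Col a b c"
  by (auto simp: betweenness.Col_def Col_def connectives point_T)

lemma abs_rep[simp]: "abs_point (rep_point x) = x"
  by (rule Quotient3_abs_rep[OF Quotient3_point])

lemma point_len_eq: "point_len a b = point_len c d \<longleftrightarrow> point_E a b c d"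
proof -
  have A2: "point_E x y u v \<Longrightarrow> point_E x y s t \<Longrightarrow> point_E u v s t" for x y u v s t
    using axioms(2)[OF T, of "rep_point x" "rep_point y" "rep_point u" "rep_point v" "rep_point s"
      "rep_point t"] by (simp add: A2_def connectives flip: point_E.abs_eq)
  have A1: "point_E x y y x" for x y
    using axioms(1)[OF T, of "rep_point x" "rep_point y"] by (simp add: A1_def flip: point_E.abs_eq)
  have refl: "point_E x y x y" for x y using A2 A1 by blast
  then have sym: "point_E x y u v \<Longrightarrow> point_E u v x y" for x y u v using A2 by blast
  show ?thesis
  proof
    assume "point_len a b = point_len c d"
    then show "point_E a b c d" using refl[of c d] by (auto simp: point_len_def)
  next
    assume "point_E a b c d"
    then have "point_E a b x y \<longleftrightarrow> point_E c d x y" for x y using A2 sym by metis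
    then show "point_len a b = point_len c d" by (simp add: point_len_def)
  qed
qed

lemma on_reps:
  "test_theory \<turnstile> Between (rep_point a) (rep_point b) (rep_point c) \<longleftrightarrow> point_B a b c"
  "test_theory \<turnstile> WBetween (rep_point a) (rep_point b) (rep_point c) \<longleftrightarrow> betweenness.T point_B a b c"
  "test_theory \<turnstile> Col (rep_point a) (rep_point b) (rep_point c) \<longleftrightarrow> betweenness.Col point_B a b c"
  "test_theory \<turnstile> Cong (rep_point a) (rep_point b) (rep_point c) (rep_point d) \<longleftrightarrow>
    point_len a b = point_len c d"
  "test_theory \<turnstile> rep_point a \<^bold>= rep_point b \<longleftrightarrow> a = b"
  by (simp_all add: point_len_eq flip: point_T point_Col point_B.abs_eq point_E.abs_eq point.abs_eq_iff)

lemma point_plane: "tarski_plane point_B point_len point_ext point_ip point_center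
    (abs_point Alpha) (abs_point Beta) (abs_point Gamma)"
proof
  note S = A1_def A2_def A3_def A4i_def A5_def A6i_def A7i_def A8_def A9_def A10\<^sub>3_def A14i_def
    A15i_def Let_def connectives on_reps
  fix a b c d p q r a' b' c' d' :: point
  let ?r = rep_point
  show "point_len a b = point_len b a" using axioms(1)[OF T, of "?r a" "?r b"] by (simp add: S)
  show "a = b" if "point_len a b = point_len c c"
    using axioms(3)[OF T, of "?r a" "?r b" "?r c"] that by (simp add: S)
  show "betweenness.T point_B q a (point_ext q a b c)" if "q \<noteq> a"
    using axioms(4)[OF T, of "?r q" "?r a" "?r b" "?r c"] that
      point_T[of "?r q" "?r a" "Ext (?r q) (?r a) (?r b) (?r c)"]
      point_ext.abs_eq[of "?r q" "?r a" "?r b" "?r c"] by (simp add: S)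
  show "point_len a (point_ext q a b c) = point_len b c" if "q \<noteq> a"
    using axioms(4)[OF T, of "?r q" "?r a" "?r b" "?r c"] that
      point_E.abs_eq[of "?r a" "Ext (?r q) (?r a) (?r b) (?r c)" "?r b" "?r c"]
      point_ext.abs_eq[of "?r q" "?r a" "?r b" "?r c"] by (simp add: S point_len_eq)
  show "point_len c d = point_len c' d'" if "a \<noteq> b" "betweenness.T point_B a b c"
    "betweenness.T point_B a' b' c'" "point_len a b = point_len a' b'" "point_len b c = point_len b' c'"
    "point_len a d = point_len a' d'" "point_len b d = point_len b' d'"
    using axioms(5)[OF T, of "?r a" "?r b" "?r c" "?r d" "?r a'" "?r b'" "?r c'" "?r d'"] that
    by (simp add: S)
  show "\<not> point_B a b a" using axioms(6)[OF T, of "?r a" "?r b"] by (simp add: S)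
  show "betweenness.T point_B p (point_ip a p c b q) b \<and> betweenness.T point_B q (point_ip a p c b q) a"
    if "point_B a p c" "betweenness.T point_B b q c" "\<not> betweenness.Col point_B a b c"
    using axioms(7)[OF T, of "?r a" "?r p" "?r c" "?r b" "?r q"] that
      point_T[of "?r p" "Ip (?r a) (?r p) (?r c) (?r b) (?r q)" "?r b"]
      point_T[of "?r q" "Ip (?r a) (?r p) (?r c) (?r b) (?r q)" "?r a"]
      point_ip.abs_eq[of "?r a" "?r p" "?r c" "?r b" "?r q"] by (simp add: S)
  show "\<not> betweenness.Col point_B (abs_point Alpha) (abs_point Beta) (abs_point Gamma)"
    using axioms(8)[OF T] by (simp add: S point_Col)
  show "betweenness.Col point_B p q r" if "a \<noteq> b" "point_len p a = point_len p b"
    "point_len q a = point_len q b" "point_len r a = point_len r b"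
    using axioms(9)[OF T, of "?r a" "?r b" "?r p" "?r q" "?r r"] that by (simp add: S)
  show "point_len a (point_center a b c) = point_len b (point_center a b c) \<and>
      point_len a (point_center a b c) = point_len c (point_center a b c)"
    if "\<not> betweenness.Col point_B a b c"
    using axioms(10)[OF T, of "?r a" "?r b" "?r c"] that
      point_E.abs_eq[of "?r a" "Center (?r a) (?r b) (?r c)" "?r b" "Center (?r a) (?r b) (?r c)"]
      point_E.abs_eq[of "?r a" "Center (?r a) (?r b) (?r c)" "?r c" "Center (?r a) (?r b) (?r c)"]
      point_center.abs_eq[of "?r a" "?r b" "?r c"] by (simp add: S point_len_eq)
  show "point_B c b a" if "point_B a b c"
    using axioms(11)[OF T, of "?r a" "?r b" "?r c"] that by (simp add: S)
  show "point_B a b c" if "point_B a b d" "point_B b c d"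
    using axioms(12)[OF T, of "?r a" "?r b" "?r c" "?r d"] that by (simp add: S)
qed

interpretation P: tarski_plane point_B point_len point_ext point_ip point_center
    "abs_point Alpha" "abs_point Beta" "abs_point Gamma"
  by (rule point_plane)

lemma abs_tms:
  "abs_point (isosceles_mid_tm a b c) = P.isosceles_mid (abs_point a) (abs_point b) (abs_point c)"
  "abs_point (foot_tm a b c) = P.foot (abs_point a) (abs_point b) (abs_point c)"
  "abs_point (guide_tm x a b w) = P.guide (abs_point x) (abs_point a) (abs_point b) (abs_point w)"
  "abs_point (project_tm x a b w) = P.project (abs_point x) (abs_point a) (abs_point b) (abs_point w)"
proof -
  note e = point_ext.abs_eq[symmetric] point_ip.abs_eq[symmetric]
  show 1: "abs_point (isosceles_mid_tm a b c) = P.isosceles_mid (abs_point a) (abs_point b) (abs_point c)"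
    for a b c by (simp add: isosceles_mid_tm_def P.isosceles_mid_def e)
  show 2: "abs_point (foot_tm a b c) = P.foot (abs_point a) (abs_point b) (abs_point c)"
    for a b c by (simp add: foot_tm_def P.foot_def Let_def e 1)
  show 3: "abs_point (guide_tm x a b w) = P.guide (abs_point x) (abs_point a) (abs_point b) (abs_point w)"
    by (simp add: guide_tm_def P.guide_def Let_def e 2)
  show "abs_point (project_tm x a b w) = P.project (abs_point x) (abs_point a) (abs_point b) (abs_point w)"
    by (simp add: project_tm_def P.project_def 2 3)
qed

lemma truth:
  "p \<^bold>\<longrightarrow> q \<in> test_theory \<longleftrightarrow> (p \<in> test_theory \<longrightarrow> q \<in> test_theory)"
  "p \<^bold>\<and> q \<in> test_theory \<longleftrightarrow> p \<in> test_theory \<and> q \<in> test_theory"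
  "Falsum \<in> test_theory \<longleftrightarrow> False"
  "s \<^bold>= t \<in> test_theory \<longleftrightarrow> abs_point s = abs_point t"
  "Between a b c \<in> test_theory \<longleftrightarrow> point_B (abs_point a) (abs_point b) (abs_point c)"
  "Cong a b c d \<in> test_theory \<longleftrightarrow>
    point_len (abs_point a) (abs_point b) = point_len (abs_point c) (abs_point d)"
  "Col a b c \<in> test_theory \<longleftrightarrow> P.Col (abs_point a) (abs_point b) (abs_point c)"
  using maxcons_simps[OF m]
  by (simp_all add: point_len_eq point.abs_eq_iff point_B.abs_eq point_E.abs_eq point_Col mem)

lemma projects_test_theory: "projects test_theory"
proof -
  have l: "abs_point (off_foot_tm a b f) =
      point_ext (abs_point a) (point_ext (abs_point a) (abs_point b) (abs_point b) (abs_point f))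
        (abs_point a) (abs_point b)" for a b f
    by (simp add: off_foot_tm_def point_ext.abs_eq)
  show ?thesis
    unfolding projects_def Let_def truth abs_tms l point_ext.abs_eq[symmetric]
    apply (intro allI impI)
    subgoal premises h for x a b w
    proof -
      let ?x = "abs_point x" and ?a = "abs_point a" and ?b = "abs_point b" and ?w = "abs_point w"
      have ab: "\<not> P.Col ?a ?b ?w" using h by auto
      note E = P.project_perp_exists[OF ab refl refl refl]
      note C = P.project_perp_contains[OF ab refl _ _ _ _ _ _ refl]
      show ?thesis
        apply (intro conjI allI impI)
        apply (simp_all add: E)
        subgoal for p q k l using C[where p = "abs_point p" and q = "abs_point q" and k = "abs_point k" and
            l = "abs_point l" and x = ?x] by simp
        done
    qed
    done
qed

end

text \<open>A set violating the claim would make \<open>test_theory\<close> such a set too, contrary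
  to \<open>projects_test_theory\<close>.\<close>

lemma projects_maxcons: "maxcons \<Delta> \<Longrightarrow> intuitionistic_tarski \<subseteq> \<Delta> \<Longrightarrow> projects \<Delta>"
  using projects_test_theory someI[of "\<lambda>\<Delta>. maxcons \<Delta> \<and> intuitionistic_tarski \<subseteq> \<Delta> \<and> \<not> projects \<Delta>" \<Delta>]
  unfolding test_theory_def[symmetric] by blast

section \<open>From maximal consistent sets back to intuitionistic derivations\<close>

context
  fixes \<Gamma> x a b w f g l H
  assumes T: "intuitionistic_tarski \<subseteq> \<Gamma>" and H: "a \<^bold>\<noteq> b \<^bold>\<and> \<^bold>\<not> Col a b w \<in> \<Gamma>"
  defines "f \<equiv> project_tm x a b w" and "g \<equiv> guide_tm x a b w" and "l \<equiv> off_foot_tm a b f"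
begin

lemma classical_consequence:
  assumes "\<And>\<Delta>. maxcons \<Delta> \<Longrightarrow> projects \<Delta> \<Longrightarrow> \<Gamma> \<subseteq> \<Delta> \<Longrightarrow> a \<^bold>\<noteq> b \<in> \<Delta> \<Longrightarrow> \<^bold>\<not> Col a b w \<in> \<Delta> \<Longrightarrow> p \<in> \<Delta>"
  shows "\<Gamma> \<turnstile> \<^bold>\<not> \<^bold>\<not> p"
proof (rule Neg_Neg_complete)
  fix \<Delta> assume d: "\<Gamma> \<subseteq> \<Delta>" "maxcons \<Delta>"
  then have "a \<^bold>\<noteq> b \<^bold>\<and> \<^bold>\<not> Col a b w \<in> \<Delta>" using H by blast
  then have "a \<^bold>\<noteq> b \<in> \<Delta>" "\<^bold>\<not> Col a b w \<in> \<Delta>" using maxcons_simps(2)[OF d(2)] by auto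
  then show "p \<in> \<Delta>" using assms[OF d(2)] projects_maxcons[OF d(2)] T d by blast
qed

lemma project_facts:
  "\<Gamma> \<turnstile> Col a b f" "\<Gamma> \<turnstile> g \<^bold>\<noteq> f" "\<Gamma> \<turnstile> l \<^bold>\<noteq> f" "\<Gamma> \<turnstile> Col a b l"
  unfolding Col_def
  by (rule Neg_stable, rule classical_consequence,
      simp add: projects_def Let_def f_def g_def l_def flip: Col_def)+

lemma project_Cong:
  assumes "Between d f l \<^bold>\<and> Cong d f f l \<in> \<Gamma>"
  shows "\<Gamma> \<turnstile> Cong g d g l"
proof (rule ImpE)
  show "\<Gamma> \<turnstile> \<^bold>\<not> \<^bold>\<not> Cong g d g l \<^bold>\<longrightarrow> Cong g d g l"
    using axioms(13)[OF T] by (simp add: stable_def)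
  show "\<Gamma> \<turnstile> \<^bold>\<not> \<^bold>\<not> Cong g d g l"
  proof (rule classical_consequence)
    fix \<Delta> assume "projects \<Delta>" "\<Gamma> \<subseteq> \<Delta>" "a \<^bold>\<noteq> b \<in> \<Delta>" "\<^bold>\<not> Col a b w \<in> \<Delta>"
    then show "Cong g d g l \<in> \<Delta>"
      unfolding projects_def Let_def using assms f_def g_def l_def by blast
  qed
qed

lemma project_contains:
  assumes "\<Gamma> \<turnstile> p \<^bold>\<noteq> q" "\<Gamma> \<turnstile> Col p q f" "\<Gamma> \<turnstile> k \<^bold>\<noteq> f" "\<Gamma> \<turnstile> Col p q k" "\<Gamma> \<turnstile> m \<^bold>\<noteq> f" "\<Gamma> \<turnstile> Col a b m"
    "\<Gamma> \<turnstile> RightAngle k f m"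
  shows "\<Gamma> \<turnstile> Col p q x"
proof -
  \<comment> \<open>Instantiating the universal quantifier of \<open>RightAngle\<close> at the
    mirror image of \<open>m\<close> in \<open>f\<close> leaves a quantifier-free hypothesis of the
    kind assumed in \<open>projects\<close>.\<close>
  define d where "d = Ext m f f m"
  have "\<Gamma> \<turnstile> Between d f m \<^bold>\<and> Cong d f f m \<^bold>\<longrightarrow> Cong k d k m"
    using ForallE[OF AndE2[OF AndE2[OF assms(7)[unfolded RightAngle_def]]], of d]
    by (simp add: inst_def Let_def)
  note hyps = assms(1-6) this
  have "\<Gamma> \<turnstile> \<^bold>\<not> \<^bold>\<not> Col p q x"
  proof (rule classical_consequence)
    fix \<Delta> assume d: "maxcons \<Delta>" "projects \<Delta>" "\<Gamma> \<subseteq> \<Delta>" "a \<^bold>\<noteq> b \<in> \<Delta>" "\<^bold>\<not> Col a b w \<in> \<Delta>"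
    note h = hyps[THEN weaken, OF d(3), unfolded maxcons_derives[OF d(1)]]
    show "Col p q x \<in> \<Delta>"
      using d(2,4,5) h unfolding projects_def Let_def d_def f_def by blast
  qed
  then show ?thesis unfolding Col_def by (rule Neg_stable)
qed

lemma Col_ends: "\<Gamma> \<turnstile> Col p q p" "\<Gamma> \<turnstile> Col p q q"
proof -
  have "t \<^bold>= t \<in> \<Delta>" if "maxcons \<Delta>" for \<Delta> t
    using maxcons_derives[OF that] EqRefl by blast
  then show "\<Gamma> \<turnstile> Col p q p" "\<Gamma> \<turnstile> Col p q q"
    unfolding Col_def
    by (rule_tac Neg_stable, rule_tac classical_consequence, simp add: maxcons_simps WBetween_def)+
qed

end

lemma lifted_hyps:
  assumes "intuitionistic_tarski \<subseteq> \<Gamma>" "a \<^bold>\<noteq> b \<^bold>\<and> \<^bold>\<not> Col a b w \<in> \<Gamma>"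
  shows "intuitionistic_tarski \<subseteq> lift_fm ` \<Gamma>"
    "lift_tm a \<^bold>\<noteq> lift_tm b \<^bold>\<and> \<^bold>\<not> Col (lift_tm a) (lift_tm b) (lift_tm w) \<in> lift_fm ` \<Gamma>"
  using image_mono[OF assms(1), of lift_fm] imageI[OF assms(2), of lift_fm] by (simp_all add: lift_tarski)

lemma PerpAt_guide:
  assumes "intuitionistic_tarski \<subseteq> \<Gamma>" "a \<^bold>\<noteq> b \<^bold>\<and> \<^bold>\<not> Col a b w \<in> \<Gamma>"
  shows "\<Gamma> \<turnstile> PerpAt (guide_tm x a b w) (project_tm x a b w) a b (project_tm x a b w)"
proof -
  define f g l where "f = project_tm x a b w" and "g = guide_tm x a b w" and "l = off_foot_tm a b f"
  note facts = project_facts[OF assms, of x, folded f_def g_def, folded l_def]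
  have ab: "\<Gamma> \<turnstile> a \<^bold>\<noteq> b" using AndE1[OF Assm[OF assms(2)]] .
  \<comment> \<open>\<open>Var 0\<close> is the eigenvariable for the point \<open>d\<close> of
    \<open>RightAngle\<close>. The lifted context again contains the axioms and the lifted
    assumption on \<open>a\<close>, \<open>b\<close>, \<open>w\<close>.\<close>
  have "insert (Between (Var 0) (lift_tm f) (lift_tm l) \<^bold>\<and> Cong (Var 0) (lift_tm f) (lift_tm f) (lift_tm l))
      (lift_fm ` \<Gamma>) \<turnstile> Cong (lift_tm g) (Var 0) (lift_tm g) (lift_tm l)"
    unfolding f_def g_def l_def lift_off_foot_tm lift_guide_tm lift_project_tm
    by (rule project_Cong) (use lifted_hyps[OF assms] in auto)
  then have "\<Gamma> \<turnstile> Forall (Between (Var 0) (lift_tm f) (lift_tm l) \<^bold>\<and>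
      Cong (Var 0) (lift_tm f) (lift_tm f) (lift_tm l) \<^bold>\<longrightarrow> Cong (lift_tm g) (Var 0) (lift_tm g) (lift_tm l))"
    by (intro ForallI ImpI)
  moreover have "\<Gamma> \<turnstile> f \<^bold>\<noteq> l"
    by (rule ImpI, rule ImpE[OF weaken[OF facts(3)]]) (auto intro: Eq_sym Assm)
  ultimately have right: "\<Gamma> \<turnstile> RightAngle g f l"
    unfolding RightAngle_def Let_def by (intro AndI facts)
  have "\<Gamma> \<turnstile> Exists (Exists (Var 1 \<^bold>\<noteq> lift_tm (lift_tm f) \<^bold>\<and>
      Col (lift_tm (lift_tm g)) (lift_tm (lift_tm f)) (Var 1) \<^bold>\<and> Var 0 \<^bold>\<noteq> lift_tm (lift_tm f) \<^bold>\<and>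
      Col (lift_tm (lift_tm a)) (lift_tm (lift_tm b)) (Var 0) \<^bold>\<and> RightAngle (Var 1) (lift_tm (lift_tm f)) (Var 0)))"
  proof (rule ExistsI[of _ _ g], simp add: inst_def, rule ExistsI[of _ _ l], simp add: inst_def)
    show "\<Gamma> \<turnstile> g \<^bold>\<noteq> f \<^bold>\<and> Col g f g \<^bold>\<and> l \<^bold>\<noteq> f \<^bold>\<and> Col a b l \<^bold>\<and> RightAngle g f l"
      by (intro AndI facts right Col_ends[OF assms])
  qed
  then show ?thesis
    unfolding PerpAt_def Let_def f_def[symmetric] g_def[symmetric]
    by (intro AndI facts ab Col_ends[OF assms])
qed

lemma PerpAt_contains:
  assumes "intuitionistic_tarski \<subseteq> \<Gamma>" "a \<^bold>\<noteq> b \<^bold>\<and> \<^bold>\<not> Col a b w \<in> \<Gamma>"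
    and perp: "PerpAt p q a b (project_tm x a b w) \<in> \<Gamma>"
  shows "\<Gamma> \<turnstile> Col p q x"
proof -
  let ?l = "\<lambda>t. lift_tm (lift_tm t)"
  define f where "f = project_tm x a b w"
  define Q where "Q = (Var 1 \<^bold>\<noteq> ?l f \<^bold>\<and> Col (?l p) (?l q) (Var 1) \<^bold>\<and> Var 0 \<^bold>\<noteq> ?l f \<^bold>\<and>
    Col (?l a) (?l b) (Var 0) \<^bold>\<and> RightAngle (Var 1) (?l f) (Var 0))"
  \<comment> \<open>The context inside two nested uses of \<open>ExistsE\<close>:
    \<open>Var 1\<close> and \<open>Var 0\<close> name the points on the two perpendicular lines,
    and everything from the original context is lifted twice.\<close>
  define \<Delta> where "\<Delta> = insert Q (lift_fm ` insert (Exists Q) (lift_fm ` \<Gamma>))"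
  have PQ: "PerpAt p q a b f = (p \<^bold>\<noteq> q \<^bold>\<and> a \<^bold>\<noteq> b \<^bold>\<and> Col p q f \<^bold>\<and> Col a b f \<^bold>\<and> Exists (Exists Q))"
    unfolding PerpAt_def Q_def Let_def ..
  have "\<Gamma> \<turnstile> Exists (Exists Q)"
    using Assm[OF perp, folded f_def, unfolded PQ, THEN AndE2, THEN AndE2, THEN AndE2, THEN AndE2] .
  moreover have "\<Delta> \<turnstile> lift_fm (lift_fm (Col p q x))"
  proof -
    note 1 = lifted_hyps[OF assms(1,2)]
    note 2 = lifted_hyps[OF 1]
    have hyps: "intuitionistic_tarski \<subseteq> \<Delta>" "?l a \<^bold>\<noteq> ?l b \<^bold>\<and> \<^bold>\<not> Col (?l a) (?l b) (?l w) \<in> \<Delta>"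
      using 2 by (auto simp: \<Delta>_def)
    have Q: "\<Delta> \<turnstile> Q" by (rule Assm) (simp add: \<Delta>_def)
    have "lift_fm (lift_fm (PerpAt p q a b f)) \<in> \<Delta>"
      using perp unfolding f_def \<Delta>_def by blast
    note P' = Assm[OF this, unfolded lift_PerpAt, unfolded PerpAt_def]
    have P: "\<Delta> \<turnstile> ?l p \<^bold>\<noteq> ?l q" "\<Delta> \<turnstile> Col (?l p) (?l q) (?l f)"
      using AndE1[OF P'] AndE1[OF AndE2[OF AndE2[OF P']]] .
    show ?thesis
      unfolding lift_Col
    proof (rule project_contains[OF hyps])
      have f: "project_tm (?l x) (?l a) (?l b) (?l w) = ?l f" by (simp add: f_def lift_project_tm)
      note Q' = Q[unfolded Q_def]
      show "\<Delta> \<turnstile> ?l p \<^bold>\<noteq> ?l q" "\<Delta> \<turnstile> Col (?l p) (?l q) (project_tm (?l x) (?l a) (?l b) (?l w))"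
        unfolding f using P .
      show "\<Delta> \<turnstile> Var 1 \<^bold>\<noteq> project_tm (?l x) (?l a) (?l b) (?l w)"
        unfolding f using AndE1[OF Q'] .
      show "\<Delta> \<turnstile> Col (?l p) (?l q) (Var 1)" using AndE1[OF AndE2[OF Q']] .
      show "\<Delta> \<turnstile> Var 0 \<^bold>\<noteq> project_tm (?l x) (?l a) (?l b) (?l w)"
        unfolding f using AndE1[OF AndE2[OF AndE2[OF Q']]] .
      show "\<Delta> \<turnstile> Col (?l a) (?l b) (Var 0)" using AndE1[OF AndE2[OF AndE2[OF AndE2[OF Q']]]] .
      show "\<Delta> \<turnstile> RightAngle (Var 1) (project_tm (?l x) (?l a) (?l b) (?l w)) (Var 0)"
        unfolding f using AndE2[OF AndE2[OF AndE2[OF AndE2[OF Q']]]] .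
    qed
  qed
  then have "insert (Exists Q) (lift_fm ` \<Gamma>) \<turnstile> lift_fm (Col p q x)"
    unfolding \<Delta>_def by (rule ExistsE[OF Assm, rotated]) simp
  ultimately show ?thesis by (rule ExistsE)
qed

lemma ErectedPerpContains_project:
  assumes "intuitionistic_tarski \<subseteq> \<Gamma>" "a \<^bold>\<noteq> b \<^bold>\<and> \<^bold>\<not> Col a b w \<in> \<Gamma>"
  shows "\<Gamma> \<turnstile> ErectedPerpContains a b (project_tm x a b w) x"
  unfolding ErectedPerpContains_def Let_def
proof (rule AndI)
  let ?l = "\<lambda>t. lift_tm (lift_tm t)"
  let ?P = "PerpAt (Var 1) (Var 0) (?l a) (?l b) (?l (project_tm x a b w))"
  show "\<Gamma> \<turnstile> Exists (Exists ?P)"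
    \<comment> \<open>The perpendicular is given by the guide point and the foot. These always
      differ, whereas \<open>x\<close> itself may be the foot.\<close>
    by (rule ExistsI[of _ _ "guide_tm x a b w"], simp add: inst_def,
        rule ExistsI[of _ _ "project_tm x a b w"], simp add: inst_def PerpAt_guide[OF assms])
  have "insert ?P (lift_fm ` lift_fm ` \<Gamma>) \<turnstile> Col (Var 1) (Var 0) (?l x)"
    unfolding lift_project_tm
    by (rule PerpAt_contains[of _ _ _ "?l w"])
      (use lifted_hyps[OF lifted_hyps[OF assms]] in auto)
  then show "\<Gamma> \<turnstile> Forall (Forall (?P \<^bold>\<longrightarrow> Col (Var 1) (Var 0) (?l x)))"
    by (intro ForallI ImpI)
qed

theorem theorem10p5:
  "\<exists>Project. tvars Project \<subseteq> {0, 1, 2, 3} \<and>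
     intuitionistic_tarski \<turnstile> Foralls 4
       (let x = Var 0; a = Var 1; b = Var 2; w = Var 3; f = Project in
          a \<^bold>\<noteq> b \<^bold>\<and> \<^bold>\<not> Col a b w \<^bold>\<longrightarrow> Col a b f \<^bold>\<and> ErectedPerpContains a b f x)"
proof (intro exI conjI)
  let ?f = "project_tm (Var 0) (Var 1) (Var 2) (Var 3)"
  show "tvars ?f \<subseteq> {0, 1, 2, 3}" by (simp add: tvars_project_tm)
  let ?\<Gamma> = "insert (Var 1 \<^bold>\<noteq> Var 2 \<^bold>\<and> \<^bold>\<not> Col (Var 1) (Var 2) (Var 3)) intuitionistic_tarski"
  have "intuitionistic_tarski \<subseteq> ?\<Gamma>" "Var 1 \<^bold>\<noteq> Var 2 \<^bold>\<and> \<^bold>\<not> Col (Var 1) (Var 2) (Var 3) \<in> ?\<Gamma>" by auto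
  then have "?\<Gamma> \<turnstile> Col (Var 1) (Var 2) ?f \<^bold>\<and> ErectedPerpContains (Var 1) (Var 2) ?f (Var 0)"
    by (intro AndI project_facts ErectedPerpContains_project)
  then show "intuitionistic_tarski \<turnstile> Foralls 4
       (let x = Var 0; a = Var 1; b = Var 2; w = Var 3; f = ?f in
          a \<^bold>\<noteq> b \<^bold>\<and> \<^bold>\<not> Col a b w \<^bold>\<longrightarrow> Col a b f \<^bold>\<and> ErectedPerpContains a b f x)"
    unfolding Let_def by (intro ForallsI[OF lift_tarski] ImpI)
qed

end
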